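(* Let $\sigma\in i\mathbb{R}$ and let $e_{kl}$ ($1\le k,l\le 4$) be the differential operators on $C_0^\infty(\mathrm{GL}_2(\mathbb{R}))$ by which the standard generators of $\mathfrak{gl}_4(\mathbb{R})$ act in the representation $U_\sigma$ (listed explicitly in the context). For $F\in C_0^\infty(\mathrm{GL}_2(\mathbb{R}))$ let $K_F(t,s|\mu_1,\epsilon_1;\mu_2,\epsilon_2)$ be the kernel of the operator $T_{\mu_1,\epsilon_1;\mu_2,\epsilon_2}(F)$ (the Fourier transform of $F$). Then for every $F\in C_0^\infty(\mathrm{GL}_2(\mathbb{R}))$ and all $1\le k,l\le 4$, $$K_{e_{kl}F}=E_{kl}K_F$$ (for all $t,s\in\mathbb{R}$, $\epsilon_1,\epsilon_2\in\mathbb{Z}/2\mathbb{Z}$, $\mu_1,\mu_2\in\mathbb{C}$ with $\mu_1\neq\mu_2$), where the operators $E_{kl}$ are given by the following formulas: $$E_{11}=-t\frac{\partial}{\partial t}-\Bigl(\tfrac12-\mu_1\Bigr),\quad E_{12}=\frac{\partial}{\partial t},\quad E_{21}=-t^2\frac{\partial}{\partial t}+(-1+\mu_1-\mu_2)t,\quad E_{22}=t\frac{\partial}{\partial t}+\Bigl(\tfrac12+\mu_2\Bigr);$$ $$E_{33}=-s\frac{\partial}{\partial s}-\Bigl(\tfrac12+\mu_1\Bigr),\quad E_{34}=\frac{\partial}{\partial s},\quad E_{43}=-s^2\frac{\partial}{\partial s}+(-1-\mu_1+\mu_2)s,\quad E_{44}=s\frac{\partial}{\partial s}+\Bigl(\tfrac12-\mu_2\Bigr);$$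 $$E_{13}=\frac{1/2-\mu_2+\sigma}{\mu_1-\mu_2}\,s\frac{\partial}{\partial t}V_2^-+\frac{1/2-\mu_1+\sigma}{\mu_1-\mu_2}\Bigl(\mu_1-\mu_2+s\frac{\partial}{\partial s}\Bigr)V_1^-,$$ $$E_{14}=\frac{-1/2-\sigma+\mu_1}{\mu_1-\mu_2}\frac{\partial}{\partial s}V_1^-+\frac{-1/2-\sigma+\mu_2}{\mu_1-\mu_2}\frac{\partial}{\partial t}V_2^-,$$ $$E_{23}=\frac{1/2-\mu_2+\sigma}{\mu_1-\mu_2}\,s\Bigl(-(\mu_1-\mu_2)+t\frac{\partial}{\partial t}\Bigr)V_2^-+\frac{1/2-\mu_1+\sigma}{\mu_1-\mu_2}\,t\Bigl(\mu_1-\mu_2+s\frac{\partial}{\partial s}\Bigr)V_1^-,$$ $$E_{24}=-\frac{1/2+\sigma-\mu_1}{\mu_1-\mu_2}\,t\frac{\partial}{\partial s}V_1^-+\frac{1/2+\sigma-\mu_2}{\mu_1-\mu_2}\Bigl(\mu_1-\mu_2-t\frac{\partial}{\partial t}\Bigr)V_2^-;$$ $$E_{31}=\frac{1/2+\mu_1+\sigma}{\mu_1-\mu_2}\Bigl(\mu_1-\mu_2-t\frac{\partial}{\partial t}\Bigr)V_1^+-\frac{1/2+\mu_2+\sigma}{\mu_1-\mu_2}\,t\frac{\partial}{\partial s}V_2^+,$$ $$E_{32}=\frac{1/2+\mu_1+\sigma}{\mu_1-\mu_2}\frac{\partial}{\partial t}V_1^++\frac{1/2+\mu_2+\sigma}{\mu_1-\mu_2}\frac{\partial}{\partial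 s}V_2^+,$$ $$E_{41}=\frac{1/2+\mu_1+\sigma}{\mu_1-\mu_2}\,s\Bigl(\mu_1-\mu_2-t\frac{\partial}{\partial t}\Bigr)V_1^+-\frac{1/2+\mu_2+\sigma}{\mu_1-\mu_2}\,t\Bigl(\mu_1-\mu_2+s\frac{\partial}{\partial s}\Bigr)V_2^+,$$ $$E_{42}=\frac{1/2+\mu_1+\sigma}{\mu_1-\mu_2}\,s\frac{\partial}{\partial t}V_1^++\frac{1/2+\mu_2+\sigma}{\mu_1-\mu_2}\Bigl(\mu_1-\mu_2+s\frac{\partial}{\partial s}\Bigr)V_2^+.$$
   Context: **Notation.** For $\mu\in\mathbb{C}$, $\epsilon\in\mathbb{Z}/2\mathbb{Z}$ and $x\in\mathbb{R}^\times$ put $x^{\mu/\!\!/\epsilon}:=|x|^\mu\,\mathrm{sgn}(x)^\epsilon$. Elements of $\mathrm{GL}_2(\mathbb{R})$ are written $X=\begin{pmatrix} x_{11} & x_{12} \\ x_{21} & x_{22} \end{pmatrix}$, $dX=dx_{11}dx_{12}dx_{21}dx_{22}$, and the Haar measure is $(\det X)^{-2}dX$. $C_0^\infty(\mathrm{GL}_2(\mathbb{R}))$ is the space of compactly supported smooth functions on $\mathrm{GL}_2(\mathbb{R})$. **Principal series.** For $\mu_1,\mu_2\in\mathbb{C}$, $\epsilon_1,\epsilon_2\in\mathbb{Z}/2\mathbb{Z}$, the representation $T_{\mu_1,\epsilon_1;\mu_2,\epsilon_2}$ of $\mathrm{GL}_2(\mathbb{R})$ is $$T_{\mu_1,\epsilon_1;\mu_2,\epsilon_2}(X)\phi(t)=\phi\Bigl(\frac{x_{12}+tx_{22}}{x_{11}+tx_{21}}\Bigr)(x_{11}+tx_{21})^{-1+\mu_1-\mu_2/\!\!/\epsilon_1-\epsilon_2}(\det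 X)^{1/2+\mu_2/\!\!/\epsilon_2},$$ acting in the space $C^\infty_{\mu_1-\mu_2,\epsilon_1-\epsilon_2}$ of $C^\infty$ functions $\phi$ on $\mathbb{R}$ such that $\phi(-1/t)(-t)^{-1+\mu_1-\mu_2/\!\!/\epsilon_1-\epsilon_2}$ is also $C^\infty$ (i.e. extends smoothly to $t=0$). **Fourier transform and kernel.** For $F\in C_0^\infty(\mathrm{GL}_2(\mathbb{R}))$, $$T_{\mu_1,\epsilon_1;\mu_2,\epsilon_2}(F)=\int_{\mathrm{GL}_2(\mathbb{R})}F(X)\,T_{\mu_1,\epsilon_1;\mu_2,\epsilon_2}(X)\frac{dX}{(\det X)^2},$$ and its kernel $K=K_F$ is defined by $T_{\mu_1,\epsilon_1;\mu_2,\epsilon_2}(F)\phi(t)=\int_{-\infty}^\infty K(t,s|\mu_1,\epsilon_1;\mu_2,\epsilon_2)\phi(s)\,ds$. **Shift operators.** $$V_1^\pm K(t,s|\mu_1,\epsilon_1;\mu_2,\epsilon_2)=K(t,s|\mu_1\pm1,\epsilon_1+1;\mu_2,\epsilon_2),\quad V_2^\pm K(t,s|\mu_1,\epsilon_1;\mu_2,\epsilon_2)=K(t,s|\mu_1,\epsilon_1;\mu_2\pm1,\epsilon_2+1).$$ In the formulas for $E_{kl}$ the shift is applied first, then the differential operator in $t,s$, then multiplication by the coefficients. **Overalgebra.** For $\sigma\in i\mathbb{R}$, $U_\sigma$ is the unitary representation of $\mathrm{GL}_4(\mathbb{R})$ in $L^2(\mathrm{GL}_2(\mathbb{R}))$ given,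 for block matrices of size $2+2$, by $$U_\sigma\begin{pmatrix} A & B \\ C & D \end{pmatrix}F(X)=F\bigl((A+XC)^{-1}(B+XD)\bigr)\left|\frac{\det(A+XC)\det(B+XD)}{\det X\,\det\begin{pmatrix} A & B \\ C & D \end{pmatrix}}\right|^{-1+\sigma}.$$ The corresponding action of the matrix units of $\mathfrak{gl}_4(\mathbb{R})$ on $C_0^\infty(\mathrm{GL}_2(\mathbb{R}))$ is given by the operators (with $\partial_{pq}=\partial/\partial x_{pq}$): $e_{11}=-x_{11}\partial_{11}-x_{12}\partial_{12}$, $e_{12}=-x_{21}\partial_{11}-x_{22}\partial_{12}$, $e_{21}=-x_{11}\partial_{21}-x_{12}\partial_{22}$, $e_{22}=-x_{21}\partial_{21}-x_{22}\partial_{22}$; $e_{33}=x_{11}\partial_{11}+x_{21}\partial_{21}$, $e_{34}=x_{11}\partial_{12}+x_{21}\partial_{22}$, $e_{43}=x_{12}\partial_{11}+x_{22}\partial_{21}$, $e_{44}=x_{12}\partial_{12}+x_{22}\partial_{22}$; $e_{13}=\partial_{11}+(-1+\sigma)\frac{x_{22}}{\det X}$, $e_{14}=\partial_{12}-(-1+\sigma)\frac{x_{21}}{\det X}$, $e_{23}=\partial_{21}-(-1+\sigma)\frac{x_{12}}{\det X}$, $e_{24}=\partial_{22}+(-1+\sigma)\frac{x_{11}}{\det X}$; $e_{31}=-(x_{11}^2\partial_{11}+x_{11}x_{12}\partial_{12}+x_{11}x_{21}\partial_{21}+x_{12}x_{21}\partial_{22})+(-1+\sigma)x_{11}$, $e_{32}=-(x_{11}x_{21}\partial_{11}+x_{11}x_{22}\partial_{12}+x_{21}^2\partial_{21}+x_{21}x_{22}\partial_{22})+(-1+\sigma)x_{21}$,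 $e_{41}=-(x_{11}x_{12}\partial_{11}+x_{12}^2\partial_{12}+x_{11}x_{22}\partial_{21}+x_{12}x_{22}\partial_{22})+(-1+\sigma)x_{12}$, $e_{42}=-(x_{12}x_{21}\partial_{11}+x_{12}x_{22}\partial_{12}+x_{21}x_{22}\partial_{21}+x_{22}^2\partial_{22})+(-1+\sigma)x_{22}$. *)

theory Defs
  imports "HOL-Analysis.Analysis" "HOL-Library.Z2"
begin

section \<open>Smooth functions\<close>

text \<open>On an open subset of a finite-dimensional space, this says that all derivatives of
  order at most \<open>k\<close> exist and are continuous.\<close>

primrec Ck_on :: "nat \<Rightarrow> 'a::real_normed_vector set \<Rightarrow> ('a \<Rightarrow> 'b::real_normed_vector) \<Rightarrow> bool" where
  "Ck_on 0 S f \<longleftrightarrow> continuous_on S f"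
| "Ck_on (Suc k) S f \<longleftrightarrow>
     (\<exists>f'. (\<forall>x\<in>S. (f has_derivative f' x) (at x)) \<and> (\<forall>v. Ck_on k S (\<lambda>x. f' x v)))"

definition smooth_on :: "'a::real_normed_vector set \<Rightarrow> ('a \<Rightarrow> 'b::real_normed_vector) \<Rightarrow> bool" where
  "smooth_on S f \<longleftrightarrow> (\<forall>k. Ck_on k S f)"

definition GL2 :: "(real^2^2) set" where
  "GL2 = {X. invertible X}"

text \<open>Functions on \<^term>\<open>GL2\<close> are represented by their extension by zero to all matrices.\<close>

definition test_functions :: "(real^2^2 \<Rightarrow> complex) set" where
  "test_functions = {F. smooth_on GL2 F \<and> compact (closure {X. F X \<noteq> 0})
     \<and> closure {X. F X \<noteq> 0} \<subseteq> GL2}"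


section \<open>Principal series, Fourier transform and its kernel\<close>

text \<open>The generalised power $|x|^\mu\,\mathrm{sgn}(x)^\epsilon$. It is meant for nonzero \<open>x\<close>;
  the value at \<open>0\<close> is \<open>0\<close>.\<close>

definition spow :: "real \<Rightarrow> complex \<Rightarrow> bit \<Rightarrow> complex" where
  "spow x \<mu> \<epsilon> = of_real \<bar>x\<bar> powr \<mu> * (if \<epsilon> = 0 then 1 else of_real (sgn x))"

definition ps_space :: "complex \<Rightarrow> bit \<Rightarrow> (real \<Rightarrow> complex) set" where
  "ps_space \<mu> \<epsilon> = {\<phi>. smooth_on UNIV \<phi> \<and>
     (\<exists>\<psi>. smooth_on UNIV \<psi> \<and> (\<forall>t. t \<noteq> 0 \<longrightarrow> \<psi> t = \<phi> (- 1 / t) * spow (- t) (- 1 + \<mu>) \<epsilon>))}"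

text \<open>At points where $x_{11}+t x_{21}=0$ the formula is to be understood by continuity; here it
  gives \<open>0\<close> there. For fixed \<open>t\<close> such \<open>X\<close> form a null set, so this does not affect
  the Fourier transform below.\<close>

definition principal_series ::
  "complex \<Rightarrow> bit \<Rightarrow> complex \<Rightarrow> bit \<Rightarrow> real^2^2 \<Rightarrow> (real \<Rightarrow> complex) \<Rightarrow> real \<Rightarrow> complex" where
  "principal_series \<mu>1 \<epsilon>1 \<mu>2 \<epsilon>2 X \<phi> t =
     \<phi> ((X$1$2 + t * X$2$2) / (X$1$1 + t * X$2$1))
     * spow (X$1$1 + t * X$2$1) (- 1 + \<mu>1 - \<mu>2) (\<epsilon>1 - \<epsilon>2)
     * spow (det X) (1/2 + \<mu>2) \<epsilon>2"

text \<open>The operator-valued integral is taken pointwise. The measure \<^term>\<open>lborel\<close> on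
  \<^typ>\<open>real^2^2\<close> is $dx_{11}\,dx_{12}\,dx_{21}\,dx_{22}$.\<close>

definition fourier ::
  "(real^2^2 \<Rightarrow> complex) \<Rightarrow> complex \<Rightarrow> bit \<Rightarrow> complex \<Rightarrow> bit \<Rightarrow> (real \<Rightarrow> complex) \<Rightarrow> real \<Rightarrow> complex" where
  "fourier F \<mu>1 \<epsilon>1 \<mu>2 \<epsilon>2 \<phi> t =
     (LINT X:GL2|lborel. F X * principal_series \<mu>1 \<epsilon>1 \<mu>2 \<epsilon>2 X \<phi> t / of_real ((det X)\<^sup>2))"

definition is_kernel ::
  "(real^2^2 \<Rightarrow> complex) \<Rightarrow> complex \<Rightarrow> bit \<Rightarrow> complex \<Rightarrow> bit \<Rightarrow> (real \<Rightarrow> real \<Rightarrow> complex) \<Rightarrow> bool" where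
  "is_kernel F \<mu>1 \<epsilon>1 \<mu>2 \<epsilon>2 k \<longleftrightarrow>
     continuous_on UNIV (\<lambda>(t, s). k t s) \<and>
     (\<forall>\<phi> \<in> ps_space (\<mu>1 - \<mu>2) (\<epsilon>1 - \<epsilon>2). \<forall>t.
        has_bochner_integral lborel (\<lambda>s. k t s * \<phi> s) (fourier F \<mu>1 \<epsilon>1 \<mu>2 \<epsilon>2 \<phi> t))"

text \<open>The argument order follows $K(t,s\,|\,\mu_1,\epsilon_1;\mu_2,\epsilon_2)$.\<close>

type_synonym kernel_family = "real \<Rightarrow> real \<Rightarrow> complex \<Rightarrow> bit \<Rightarrow> complex \<Rightarrow> bit \<Rightarrow> complex"

text \<open>Continuity in \<open>(t, s)\<close> makes the kernel unique as a function, rather than only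
  almost everywhere in \<open>s\<close>.\<close>

definition fourier_kernel :: "(real^2^2 \<Rightarrow> complex) \<Rightarrow> kernel_family" where
  "fourier_kernel F t s \<mu>1 \<epsilon>1 \<mu>2 \<epsilon>2 = (THE k. is_kernel F \<mu>1 \<epsilon>1 \<mu>2 \<epsilon>2 k) t s"


section \<open>The action of the overalgebra\<close>

definition partial :: "2 \<Rightarrow> 2 \<Rightarrow> (real^2^2 \<Rightarrow> complex) \<Rightarrow> real^2^2 \<Rightarrow> complex" where
  "partial p q F X = vector_derivative (\<lambda>h. F (X + h *\<^sub>R axis p (axis q 1))) (at 0)"

text \<open>The operator $e_{kl}$ ($1\le k,l\le 4$) by which the matrix unit with entry 1 in row
  \<open>k\<close> and column \<open>l\<close> acts on \<^term>\<open>test_functions\<close>: the derivative at the identity, in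
  that direction, of the representation $U_\sigma$ that sends a matrix $g$ with $2\times 2$
  blocks $A,B$ (first row) and $C,D$ (second row) to the operator
  $$U_\sigma(g)F(X)=F\bigl((A+XC)^{-1}(B+XD)\bigr)
    \left|\frac{\det(A+XC)\det(B+XD)}{\det X\,\det g}\right|^{-1+\sigma}.$$\<close>

definition e_op ::
  "complex \<Rightarrow> nat \<Rightarrow> nat \<Rightarrow> (real^2^2 \<Rightarrow> complex) \<Rightarrow> real^2^2 \<Rightarrow> complex" where
  "e_op \<sigma> k l F X =
    (let x11 = of_real (X$1$1); x12 = of_real (X$1$2);
         x21 = of_real (X$2$1); x22 = of_real (X$2$2);
         D = of_real (det X); f = F X;
         d11 = partial 1 1 F X; d12 = partial 1 2 F X;
         d21 = partial 2 1 F X; d22 = partial 2 2 F X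
     in
     [[ - x11 * d11 - x12 * d12,
        - x21 * d11 - x22 * d12,
        d11 + (- 1 + \<sigma>) * (x22 / D) * f,
        d12 - (- 1 + \<sigma>) * (x21 / D) * f],
      [ - x11 * d21 - x12 * d22,
        - x21 * d21 - x22 * d22,
        d21 - (- 1 + \<sigma>) * (x12 / D) * f,
        d22 + (- 1 + \<sigma>) * (x11 / D) * f],
      [ - (x11\<^sup>2 * d11 + x11 * x12 * d12 + x11 * x21 * d21 + x12 * x21 * d22) + (- 1 + \<sigma>) * x11 * f,
        - (x11 * x21 * d11 + x11 * x22 * d12 + x21\<^sup>2 * d21 + x21 * x22 * d22) + (- 1 + \<sigma>) * x21 * f,
        x11 * d11 + x21 * d21,
        x11 * d12 + x21 * d22],
      [ - (x11 * x12 * d11 + x12\<^sup>2 * d12 + x11 * x22 * d21 + x12 * x22 * d22) + (- 1 + \<sigma>) * x12 * f,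
        - (x12 * x21 * d11 + x12 * x22 * d12 + x21 * x22 * d21 + x22\<^sup>2 * d22) + (- 1 + \<sigma>) * x22 * f,
        x12 * d11 + x22 * d21,
        x12 * d12 + x22 * d22]]
     ! (k - 1) ! (l - 1))"


section \<open>Differential-difference operators on kernels\<close>

definition Dt :: "kernel_family \<Rightarrow> kernel_family" where
  "Dt K t s \<mu>1 \<epsilon>1 \<mu>2 \<epsilon>2 = vector_derivative (\<lambda>t'. K t' s \<mu>1 \<epsilon>1 \<mu>2 \<epsilon>2) (at t)"

definition Ds :: "kernel_family \<Rightarrow> kernel_family" where
  "Ds K t s \<mu>1 \<epsilon>1 \<mu>2 \<epsilon>2 = vector_derivative (\<lambda>s'. K t s' \<mu>1 \<epsilon>1 \<mu>2 \<epsilon>2) (at s)"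

definition V1p :: "kernel_family \<Rightarrow> kernel_family" where
  "V1p K t s \<mu>1 \<epsilon>1 \<mu>2 \<epsilon>2 = K t s (\<mu>1 + 1) (\<epsilon>1 + 1) \<mu>2 \<epsilon>2"

definition V1m :: "kernel_family \<Rightarrow> kernel_family" where
  "V1m K t s \<mu>1 \<epsilon>1 \<mu>2 \<epsilon>2 = K t s (\<mu>1 - 1) (\<epsilon>1 + 1) \<mu>2 \<epsilon>2"

definition V2p :: "kernel_family \<Rightarrow> kernel_family" where
  "V2p K t s \<mu>1 \<epsilon>1 \<mu>2 \<epsilon>2 = K t s \<mu>1 \<epsilon>1 (\<mu>2 + 1) (\<epsilon>2 + 1)"

definition V2m :: "kernel_family \<Rightarrow> kernel_family" where
  "V2m K t s \<mu>1 \<epsilon>1 \<mu>2 \<epsilon>2 = K t s \<mu>1 \<epsilon>1 (\<mu>2 - 1) (\<epsilon>2 + 1)"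

definition E_op :: "complex \<Rightarrow> nat \<Rightarrow> nat \<Rightarrow> kernel_family \<Rightarrow> kernel_family" where
  "E_op \<sigma> k l K t s \<mu>1 \<epsilon>1 \<mu>2 \<epsilon>2 =
    (let at_pt = (\<lambda>L :: kernel_family. L t s \<mu>1 \<epsilon>1 \<mu>2 \<epsilon>2);
         t = of_real t; s = of_real s; m = \<mu>1 - \<mu>2
     in
     [[ - t * at_pt (Dt K) - (1/2 - \<mu>1) * at_pt K,
        at_pt (Dt K),
        (1/2 - \<mu>2 + \<sigma>) / m * s * at_pt (Dt (V2m K))
          + (1/2 - \<mu>1 + \<sigma>) / m * (m * at_pt (V1m K) + s * at_pt (Ds (V1m K))),
        (- 1/2 - \<sigma> + \<mu>1) / m * at_pt (Ds (V1m K))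
          + (- 1/2 - \<sigma> + \<mu>2) / m * at_pt (Dt (V2m K))],
      [ - t\<^sup>2 * at_pt (Dt K) + (- 1 + \<mu>1 - \<mu>2) * t * at_pt K,
        t * at_pt (Dt K) + (1/2 + \<mu>2) * at_pt K,
        (1/2 - \<mu>2 + \<sigma>) / m * s * (- m * at_pt (V2m K) + t * at_pt (Dt (V2m K)))
          + (1/2 - \<mu>1 + \<sigma>) / m * t * (m * at_pt (V1m K) + s * at_pt (Ds (V1m K))),
        - ((1/2 + \<sigma> - \<mu>1) / m) * t * at_pt (Ds (V1m K))
          + (1/2 + \<sigma> - \<mu>2) / m * (m * at_pt (V2m K) - t * at_pt (Dt (V2m K)))],
      [ (1/2 + \<mu>1 + \<sigma>) / m * (m * at_pt (V1p K) - t * at_pt (Dt (V1p K)))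
          - (1/2 + \<mu>2 + \<sigma>) / m * t * at_pt (Ds (V2p K)),
        (1/2 + \<mu>1 + \<sigma>) / m * at_pt (Dt (V1p K))
          + (1/2 + \<mu>2 + \<sigma>) / m * at_pt (Ds (V2p K)),
        - s * at_pt (Ds K) - (1/2 + \<mu>1) * at_pt K,
        at_pt (Ds K)],
      [ (1/2 + \<mu>1 + \<sigma>) / m * s * (m * at_pt (V1p K) - t * at_pt (Dt (V1p K)))
          - (1/2 + \<mu>2 + \<sigma>) / m * t * (m * at_pt (V2p K) + s * at_pt (Ds (V2p K))),
        (1/2 + \<mu>1 + \<sigma>) / m * s * at_pt (Dt (V1p K))
          + (1/2 + \<mu>2 + \<sigma>) / m * (m * at_pt (V2p K) + s * at_pt (Ds (V2p K))),
        - s\<^sup>2 * at_pt (Ds K) + (- 1 - \<mu>1 + \<mu>2) * s * at_pt K,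
        s * at_pt (Ds K) + (1/2 - \<mu>2) * at_pt K]]
     ! (k - 1) ! (l - 1))"

end

theory Submission
  imports Defs "HOL-Real_Asymp.Real_Asymp"
begin

text \<open>
  For fixed $t$, every matrix $X$ with $x_{11} + t x_{21} \neq 0$ factors uniquely as
  $$X = \begin{pmatrix} 1 & -t \cr 0 & 1 \end{pmatrix}
        \begin{pmatrix} u & 0 \cr a & w \end{pmatrix}
        \begin{pmatrix} 1 & s \cr 0 & 1 \end{pmatrix},$$
  and then $\det X = uw$, the point $s$ is the image of $t$ under the fractional linear map in the
  principal series, and $dX = |u|\,du\,dw\,da\,ds$ (lemma \<open>lborel_eq_distr_gmat\<close>). Integrating
  out $u, w, a$ in the Fourier transform therefore gives the kernel explicitly:
  $$K_F(t,s) = \int F(X)\, u^{\mu_1-3/2 /\!/ \epsilon_1}\, w^{\mu_2-3/2 /\!/ \epsilon_2}\,du\,dw\,da$$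
  (\<open>fourier_kernel_eq_kint\<close>). Kernels are unique because the principal series space contains enough
  bump functions (\<open>is_kernel_unique\<close>), so this formula applies to $F$ and to $e_{kl}F$ alike.

  In this formula the shift $V_1^\pm$ is multiplication of the integrand by $u^{\pm1}$ and $V_2^\pm$ is
  multiplication by $w^{\pm1}$. Write $G(t,s,u,w,a) = F(X)$. Since $F$ vanishes near singular
  matrices, the integrand is of class $C^1$ with compact support, so $\partial_t$ and $\partial_s$ pass
  under the integral and the derivatives in $u$, $w$, $a$ may be integrated by parts. Both facts are
  one statement, \<open>kint_derivative\<close>: differentiate the integral along a line in the space of all
  five parameters and use translation invariance in $(u,w,a)$.

  The four derivatives of $F$ give five derivatives of $G$, which hence satisfy one relation,
  $$u\,\partial_t G + w\,\partial_s G + a u\,\partial_u G - a w\,\partial_w G = 0 .$$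
  It expresses that $X$ stays fixed when $t$ moves and $s$ follows as its image. Integrated against
  the weight it reads
  $(\mu_1-\mu_2) \int a\,G = \partial_t V_1^+ K + \partial_s V_2^+ K$, and after division by $uw$ it gives
  the analogous formula for $\int a\,G/(uw)$ with $V_2^-$ and $V_1^-$ (\<open>wint_a_plus\<close>,
  \<open>wint_a_minus\<close>). This is where the operators that are quadratic in $X$, or contain
  $1/\det X$, acquire both shifts and the denominator $\mu_1-\mu_2$. Each of the sixteen formulas is
  then an identity between rational functions of $u, w, a, t, s$: the function $e_{kl}F$ equals the
  integrand of $E_{kl}K$ up to total derivatives in $u, w, a$.
\<close>


section \<open>Bump functions in the principal series and uniqueness of kernels\<close>

lemma Ck_on_cmult:
  fixes f :: "'a::real_normed_vector \<Rightarrow> complex"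
  shows "Ck_on k S f \<Longrightarrow> Ck_on k S (\<lambda>x. c * f x)"
proof (induction k arbitrary: f)
  case 0
  then show ?case by (auto intro: continuous_intros)
next
  case (Suc k)
  then obtain f' where f': "\<And>x. x \<in> S \<Longrightarrow> (f has_derivative f' x) (at x)" "\<And>v. Ck_on k S (\<lambda>x. f' x v)"
    by auto
  have "\<forall>x\<in>S. ((\<lambda>x. c * f x) has_derivative (\<lambda>v. c * f' x v)) (at x)"
    using f'(1) by (auto intro: has_derivative_mult_right)
  moreover have "\<forall>v. Ck_on k S (\<lambda>x. c * f' x v)"
    using Suc.IH f'(2) by blast
  ultimately show ?case by (auto intro!: exI[of _ "\<lambda>x v. c * f' x v"])
qed

lemma Ck_on_add:
  assumes "Ck_on k S f" "Ck_on k S g"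
  shows "Ck_on k S (\<lambda>x. f x + g x)"
  using assms
proof (induction k arbitrary: f g)
  case 0
  then show ?case by (auto intro: continuous_intros)
next
  case (Suc k)
  from Suc.prems(1) obtain f' where f': "\<And>x. x \<in> S \<Longrightarrow> (f has_derivative f' x) (at x)" "\<And>v. Ck_on k S (\<lambda>x. f' x v)"
    by auto
  from Suc.prems(2) obtain g' where g': "\<And>x. x \<in> S \<Longrightarrow> (g has_derivative g' x) (at x)" "\<And>v. Ck_on k S (\<lambda>x. g' x v)"
    by auto
  have "\<forall>x\<in>S. ((\<lambda>x. f x + g x) has_derivative (\<lambda>v. f' x v + g' x v)) (at x)"
    using f'(1) g'(1) by (auto intro: has_derivative_add)
  moreover have "\<forall>v. Ck_on k S (\<lambda>x. f' x v + g' x v)"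
    using Suc.IH f'(2) g'(2) by blast
  ultimately show ?case by (auto intro!: exI[of _ "\<lambda>x v. f' x v + g' x v"])
qed

lemma Ck_on_SucI_real:
  fixes f :: "real \<Rightarrow> complex"
  assumes "\<And>x. (f has_vector_derivative d x) (at x)" "Ck_on k UNIV d"
  shows "Ck_on (Suc k) UNIV f"
proof -
  have "Ck_on k UNIV (\<lambda>x. v *\<^sub>R d x)" for v
    using Ck_on_cmult[OF assms(2), of "of_real v"] by (simp add: scaleR_conv_of_real)
  then show ?thesis
    using assms(1) by (auto simp: has_vector_derivative_def intro!: exI[of _ "\<lambda>x v. v *\<^sub>R d x"])
qed

text \<open>The factor $y^{-i}$ makes the family closed under differentiation, so that smoothness follows by
  induction on the order without formulas for higher derivatives.\<close>

definition flat :: "real \<Rightarrow> nat \<Rightarrow> real \<Rightarrow> real" where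
  "flat p i y = (if y > 0 then exp (- p / y) / y ^ i else 0)"

lemma flat_tendsto_0:
  assumes "p > 0"
  shows "(flat p i \<longlongrightarrow> 0) (at 0)"
proof -
  have *: "((\<lambda>z. exp (- p * z) * z ^ i) \<longlongrightarrow> 0) at_top"
    using assms by real_asymp
  have "((\<lambda>y. exp (- p * inverse y) * inverse y ^ i) \<longlongrightarrow> 0) (at_right 0)"
    using * by (rule filterlim_compose) (rule filterlim_inverse_at_top_right)
  then have R: "(flat p i \<longlongrightarrow> 0) (at_right 0)"
    by (rule Lim_transform_eventually)
       (auto simp: flat_def eventually_at_filter field_simps)
  have L: "(flat p i \<longlongrightarrow> 0) (at_left 0)"
    by (rule Lim_transform_eventually[OF tendsto_const])
       (auto simp: flat_def eventually_at_filter)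
  show ?thesis using L R by (simp add: filterlim_split_at)
qed

lemma flat_has_derivative:
  assumes "p > 0"
  shows "(flat p i has_real_derivative - real i * flat p (Suc i) y + p * flat p (Suc (Suc i)) y) (at y)"
proof -
  consider "y > 0" | "y < 0" | "y = 0" by linarith
  then show ?thesis
  proof cases
    case 1
    have "((\<lambda>y. exp (- p / y) / y ^ i) has_real_derivative - real i * flat p (Suc i) y + p * flat p (Suc (Suc i)) y) (at y)"
      using 1
      apply (cases i)
       apply (auto intro!: derivative_eq_intros simp: flat_def field_simps power2_eq_square)
      apply (metis Suc_pred neq0_conv power_Suc)
      done
    then show ?thesis
      apply (rule has_field_derivative_transform_within_open[where S="{0<..}"])
      using 1 by (auto simp: flat_def)
  next
    case 2
    have "((\<lambda>y. 0) has_real_derivative - real i * flat p (Suc i) y + p * flat p (Suc (Suc i)) y) (at y)"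
      using 2 by (auto simp: flat_def)
    then show ?thesis
      apply (rule has_field_derivative_transform_within_open[where S="{..<0}"])
      using 2 by (auto simp: flat_def)
  next
    case 3
    have "((\<lambda>h. flat p i h / h) \<longlongrightarrow> 0) (at 0)"
      by (rule Lim_transform_eventually[OF flat_tendsto_0[OF assms, of "Suc i"]])
         (auto simp: flat_def eventually_at_filter)
    then show ?thesis
      using 3 by (simp add: DERIV_def flat_def)
  qed
qed

text \<open>A bump supported in $r x \in [\alpha,\beta]$, where $r = \pm 1$ selects the half-line. The parameters
  \<open>i\<close>, \<open>j\<close>, \<open>\<nu>\<close> make the family closed under differentiation; \<open>p\<close>, \<open>q\<close>, \<open>\<nu>\<close> and the
  sign of \<open>r\<close> make it closed, up to constants, under $\phi(s) \mapsto \phi(-1/t)\,|t|^{\nu}$.\<close>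

definition bump :: "real \<Rightarrow> real \<Rightarrow> real \<Rightarrow> real \<Rightarrow> real \<Rightarrow> nat \<Rightarrow> nat \<Rightarrow> complex \<Rightarrow> real \<Rightarrow> complex" where
  "bump r \<alpha> \<beta> p q i j \<nu> x =
     of_real (r * x) powr \<nu> * of_real (flat p i (r * x - \<alpha>)) * of_real (flat q j (\<beta> - r * x))"

lemma bump_has_derivative:
  assumes "p > 0" "q > 0" "\<alpha> > 0"
  shows "(bump r \<alpha> \<beta> p q i j \<nu> has_vector_derivative
     of_real r * (\<nu> * bump r \<alpha> \<beta> p q i j (\<nu> - 1) x
      + ((- of_nat i) * bump r \<alpha> \<beta> p q (Suc i) j \<nu> x + of_real p * bump r \<alpha> \<beta> p q (Suc (Suc i)) j \<nu> x)
      + (of_nat j * bump r \<alpha> \<beta> p q i (Suc j) \<nu> x + (- of_real q) * bump r \<alpha> \<beta> p q i (Suc (Suc j)) \<nu> x))) (at x)"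
proof (cases "r * x > 0")
  case True
  have P: "((\<lambda>x. of_real (r * x) powr \<nu>) has_vector_derivative of_real r * \<nu> * of_real (r * x) powr (\<nu> - 1)) (at x)"
  proof -
    have "((\<lambda>z. z powr \<nu>) has_field_derivative \<nu> * of_real (r * x) powr (\<nu> - 1)) (at (of_real (r * x)))"
      using True by (intro has_field_derivative_powr) (auto simp: complex_nonpos_Reals_iff)
    moreover have "((\<lambda>x. complex_of_real (r * x)) has_vector_derivative of_real r) (at x)"
      by (auto intro!: derivative_eq_intros has_vector_derivative_of_real)
    ultimately show ?thesis
      using field_vector_diff_chain_at[of "\<lambda>x. complex_of_real (r * x)" "of_real r" x "\<lambda>z. z powr \<nu>"]
      by (simp add: o_def mult.assoc)
  qed
  have F1: "((\<lambda>x. flat p i (r * x - \<alpha>)) has_real_derivative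
     (- real i * flat p (Suc i) (r * x - \<alpha>) + p * flat p (Suc (Suc i)) (r * x - \<alpha>)) * r) (at x)"
    by (rule DERIV_chain2[OF flat_has_derivative[OF assms(1)]]) (auto intro!: derivative_eq_intros)
  have F2: "((\<lambda>x. flat q j (\<beta> - r * x)) has_real_derivative
     (- real j * flat q (Suc j) (\<beta> - r * x) + q * flat q (Suc (Suc j)) (\<beta> - r * x)) * (- r)) (at x)"
    by (rule DERIV_chain2[OF flat_has_derivative[OF assms(2)]]) (auto intro!: derivative_eq_intros)
  note D = has_vector_derivative_mult[OF has_vector_derivative_mult[OF P
     has_vector_derivative_of_real[OF F1]] has_vector_derivative_of_real[OF F2]]
  show ?thesis
    unfolding bump_def
    by (rule has_vector_derivative_eq_rhs[OF D]) (simp add: algebra_simps)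
next
  case False
  have "((\<lambda>x. 0) has_vector_derivative (0::complex)) (at x)" by simp
  then have "(bump r \<alpha> \<beta> p q i j \<nu> has_vector_derivative 0) (at x)"
    apply (rule has_vector_derivative_transform_within_open[where S="{x. r * x < \<alpha>}"])
    using False assms by (auto simp: bump_def flat_def intro!: open_Collect_less continuous_intros)
  then show ?thesis
    using False assms by (simp add: bump_def flat_def)
qed

lemma smooth_bump:
  assumes "p > 0" "q > 0" "\<alpha> > 0"
  shows "smooth_on UNIV (bump r \<alpha> \<beta> p q i j \<nu>)"
proof -
  note D = bump_has_derivative[OF assms]
  have "Ck_on k UNIV (bump r \<alpha> \<beta> p q i j \<nu>)" for k i j \<nu>
  proof (induction k arbitrary: i j \<nu>)
    case 0
    then show ?case
      using D has_vector_derivative_continuous by (simp add: continuous_on_eq_continuous_at) blast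
  next
    case (Suc k)
    show ?case
      by (rule Ck_on_SucI_real[OF D]) (intro Ck_on_cmult Ck_on_add Suc.IH)
  qed
  then show ?thesis by (simp add: smooth_on_def)
qed

text \<open>Inversion $x = 1/\tau$ turns $1/(x - \alpha)$ into a constant plus a multiple of
  $1/(1/\alpha - \tau)$, so a bump on $[\alpha,\beta]$ becomes a bump on $[1/\beta,1/\alpha]$. This and the
  next lemma treat the two end points.\<close>

lemma flat_inv_left:
  assumes "\<alpha> > 0" "\<tau> > 0"
  shows "flat 1 0 (1 / \<tau> - \<alpha>) = exp (1 / \<alpha>) * flat (1 / \<alpha>\<^sup>2) 0 (1 / \<alpha> - \<tau>)"
proof (cases "1 / \<tau> > \<alpha>")
  case True
  then have t: "\<alpha> * \<tau> < 1" "\<tau> < 1 / \<alpha>" using assms by (auto simp: field_simps)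
  have "- 1 / (1 / \<tau> - \<alpha>) = 1 / \<alpha> - (1 / \<alpha>\<^sup>2) / (1 / \<alpha> - \<tau>)"
    using assms t by (simp add: divide_simps) (simp add: algebra_simps power2_eq_square)
  then show ?thesis using True t by (simp add: flat_def flip: exp_add)
next
  case False
  then show ?thesis using assms by (auto simp: flat_def field_simps)
qed

lemma flat_inv_right:
  assumes "\<beta> > 0" "\<tau> > 0"
  shows "flat 1 0 (\<beta> - 1 / \<tau>) = exp (- 1 / \<beta>) * flat (1 / \<beta>\<^sup>2) 0 (\<tau> - 1 / \<beta>)"
proof (cases "1 / \<tau> < \<beta>")
  case True
  then have t: "1 < \<beta> * \<tau>" "1 / \<beta> < \<tau>" using assms by (auto simp: field_simps)
  have "- 1 / (\<beta> - 1 / \<tau>) = - 1 / \<beta> - (1 / \<beta>\<^sup>2) / (\<tau> - 1 / \<beta>)"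
    using assms t by (simp add: divide_simps) (simp add: algebra_simps power2_eq_square)
  then show ?thesis using True t by (simp add: flat_def flip: exp_add)
next
  case False
  then show ?thesis using assms by (auto simp: flat_def field_simps)
qed

lemma bump_in_ps_space:
  assumes "0 < \<alpha>" "\<alpha> < \<beta>" "r = 1 \<or> r = - 1"
  shows "bump r \<alpha> \<beta> 1 1 0 0 0 \<in> ps_space \<mu> \<epsilon>"
proof -
  define \<kappa> :: complex where "\<kappa> = (if \<epsilon> = 0 then 1 else of_real r)"
  define \<psi> where "\<psi> t = \<kappa> * of_real (exp (1 / \<alpha>) * exp (- 1 / \<beta>))
      * bump (- r) (1 / \<beta>) (1 / \<alpha>) (1 / \<beta>\<^sup>2) (1 / \<alpha>\<^sup>2) 0 0 (\<mu> - 1) t" for t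
  have b: "\<beta> > 0" using assms by simp
  have "smooth_on UNIV (bump (- r) (1 / \<beta>) (1 / \<alpha>) (1 / \<beta>\<^sup>2) (1 / \<alpha>\<^sup>2) 0 0 (\<mu> - 1))"
    using assms by (intro smooth_bump) auto
  then have "smooth_on UNIV \<psi>"
    unfolding \<psi>_def smooth_on_def by (auto intro: Ck_on_cmult)
  moreover have "\<psi> t = bump r \<alpha> \<beta> 1 1 0 0 0 (- 1 / t) * spow (- t) (- 1 + \<mu>) \<epsilon>" if "t \<noteq> 0" for t
  proof (cases "- r * t > 0")
    case True
    define \<tau> where "\<tau> = - r * t"
    have \<tau>: "\<tau> > 0" "r * (- 1 / t) = 1 / \<tau>" "- r * t = \<tau>" "\<bar>- t\<bar> = \<tau>" "sgn (- t) = r"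
      using True assms(3) that by (auto simp: \<tau>_def)
    have z: "of_real (1 / \<tau>) powr (0::complex) = 1" using \<tau>(1) by (simp add: powr_def)
    have s: "spow (- t) (- 1 + \<mu>) \<epsilon> = \<kappa> * of_real \<tau> powr (\<mu> - 1)"
      unfolding spow_def \<tau>(4,5) \<kappa>_def by (simp add: add.commute)
    show ?thesis
      unfolding \<psi>_def bump_def \<tau>(2,3) s z
      using flat_inv_left[OF assms(1) \<tau>(1)] flat_inv_right[OF b \<tau>(1)]
      by simp
  next
    case False
    then have "r * (- 1 / t) < 0"
      using that assms(3) by (auto simp: zero_less_mult_iff)
    moreover from False that have rt: "r * t > 0"
      using assms(3) by (auto simp: zero_less_mult_iff)
    moreover have "1 / \<beta> > 0" using b by simp
    then have "\<not> 1 / \<beta> < - (r * t)" using rt by linarith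
    ultimately show ?thesis
      using False assms by (simp add: \<psi>_def bump_def flat_def)
  qed
  moreover have "smooth_on UNIV (bump r \<alpha> \<beta> 1 1 0 0 0)"
    using assms by (intro smooth_bump) auto
  ultimately show ?thesis
    unfolding ps_space_def by blast
qed

text \<open>The difference of two kernels is continuous in \<open>s\<close> and orthogonal to all bumps supported on one
  side of \<open>0\<close>. Were it nonzero at some $s \neq 0$, a bump concentrated near \<open>s\<close> would detect it; the
  value at \<open>0\<close> follows by continuity.\<close>

lemma is_kernel_unique:
  assumes "is_kernel F \<mu>1 \<epsilon>1 \<mu>2 \<epsilon>2 k1" "is_kernel F \<mu>1 \<epsilon>1 \<mu>2 \<epsilon>2 k2"
  shows "k1 = k2"
proof (intro ext)
  fix t s0
  define h where "h s = k1 t s - k2 t s" for s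
  have ch: "continuous_on UNIV h"
  proof -
    have "continuous_on UNIV (\<lambda>s. (case (t, s) of (t, s) \<Rightarrow> k t s))" if "is_kernel F \<mu>1 \<epsilon>1 \<mu>2 \<epsilon>2 k" for k
      using that unfolding is_kernel_def
      by (intro continuous_on_compose2[of UNIV "\<lambda>(t, s). k t s" UNIV "Pair t"]) (auto intro: continuous_intros)
    from this[OF assms(1)] this[OF assms(2)] show ?thesis
      unfolding h_def by (auto intro: continuous_intros)
  qed
  have orth: "has_bochner_integral lborel (\<lambda>s. h s * \<phi> s) 0" if "\<phi> \<in> ps_space (\<mu>1 - \<mu>2) (\<epsilon>1 - \<epsilon>2)" for \<phi>
  proof -
    have "has_bochner_integral lborel (\<lambda>s. k1 t s * \<phi> s) (fourier F \<mu>1 \<epsilon>1 \<mu>2 \<epsilon>2 \<phi> t)"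
         "has_bochner_integral lborel (\<lambda>s. k2 t s * \<phi> s) (fourier F \<mu>1 \<epsilon>1 \<mu>2 \<epsilon>2 \<phi> t)"
      using assms that by (auto simp: is_kernel_def)
    from has_bochner_integral_diff[OF this] show ?thesis by (simp add: h_def algebra_simps)
  qed
  have nz: "h s = 0" if "s \<noteq> 0" for s
  proof (rule ccontr)
    assume hs: "h s \<noteq> 0"
    \<comment> \<open>The bumps live on one half-line, so first pass to the one that contains \<open>s\<close>.\<close>
    define r where "r = sgn s"
    have r: "r = 1 \<or> r = - 1" "r * s > 0" "r * r = 1"
      using that by (auto simp: r_def sgn_if)
    define g where "g x = Re (cnj (h s) * h x)" for x
    have gc: "continuous_on UNIV g"
      unfolding g_def by (intro continuous_intros ch)
    have gs: "g s > 0"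
      unfolding g_def using hs by (simp add: complex_neq_0 flip: power2_eq_square)
    have "open {x. g x > 0}" by (intro open_Collect_less continuous_intros gc)
    with gs obtain e where e: "e > 0" "\<And>x. dist x s < e \<Longrightarrow> g x > 0"
      by (auto simp: open_dist)
    define d where "d = min e (r * s / 2)"
    have d: "d > 0" "d \<le> e" "d < r * s" using e r(2) by (auto simp: d_def)
    define \<phi> where "\<phi> = bump r (r * s - d) (r * s + d) 1 1 0 0 0"
    define f where "f x = flat 1 0 (r * x - (r * s - d)) * flat 1 0 (r * s + d - r * x)" for x
    have fp: "f x > 0 \<longleftrightarrow> dist x s < d" and f0: "f x \<ge> 0" for x
      using r(1) d by (auto simp: f_def flat_def dist_real_def zero_less_mult_iff)
    have \<phi>f: "\<phi> x = of_real (f x)" for x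
    proof (cases "r * x = 0")
      case False
      then show ?thesis by (simp add: \<phi>_def bump_def f_def powr_def)
    next
      case True
      then show ?thesis using d by (auto simp: \<phi>_def bump_def f_def flat_def)
    qed
    have "\<phi> \<in> ps_space (\<mu>1 - \<mu>2) (\<epsilon>1 - \<epsilon>2)"
      unfolding \<phi>_def using d r by (intro bump_in_ps_space) auto
    from has_bochner_integral_mult_right[OF orth[OF this], of "cnj (h s)"]
    have "has_bochner_integral lborel (\<lambda>x. cnj (h s) * (h x * \<phi> x)) 0" by simp
    from has_bochner_integral_Re[OF this]
    have I: "has_bochner_integral lborel (\<lambda>x. g x * f x) 0"
      by (simp add: g_def \<phi>f algebra_simps)
    have pos: "g x * f x \<ge> 0" for x
      using f0[of x] fp[of x] e(2)[of x] d(2) by (cases "f x > 0") (auto simp: not_less)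
    have "AE x in lborel. g x * f x = 0"
      using integral_nonneg_eq_0_iff_AE[of lborel "\<lambda>x. g x * f x"] I pos
      by (auto simp: has_bochner_integral_iff)
    then have "AE x in lborel. x \<notin> ball s d"
    proof (rule AE_mp, intro AE_I2 impI)
      fix x assume "g x * f x = 0"
      then show "x \<notin> ball s d"
        using fp[of x] e(2)[of x] d(2) by (auto simp: dist_commute)
    qed
    then have "emeasure lborel (ball s d) = 0"
      by (subst (asm) AE_iff_measurable[of "ball s d"]) auto
    then show False
      using d(1) by (simp add: emeasure_lborel_ball_finite ball_eq_greaterThanLessThan)
  qed
  have "h s0 = 0"
  proof (cases "s0 = 0")
    case True
    have "(h \<longlongrightarrow> h 0) (at 0)"
      using ch by (simp add: continuous_on_def)
    moreover have "(h \<longlongrightarrow> 0) (at 0)"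
      by (rule Lim_transform_eventually[OF tendsto_const]) (auto simp: eventually_at_filter nz)
    ultimately show ?thesis using True tendsto_unique by (metis trivial_limit_at)
  qed (rule nz)
  then show "k1 t s0 = k2 t s0" by (simp add: h_def)
qed

section \<open>The coordinates $(s,u,w,a)$ and Lebesgue measure\<close>

definition mat2 :: "real \<Rightarrow> real \<Rightarrow> real \<Rightarrow> real \<Rightarrow> real^2^2" where
  "mat2 x11 x12 x21 x22 = x11 *\<^sub>R axis 1 (axis 1 1) + x12 *\<^sub>R axis 1 (axis 2 1)
     + x21 *\<^sub>R axis 2 (axis 1 1) + x22 *\<^sub>R axis 2 (axis 2 1)"

lemma mat2_nth [simp]:
  "mat2 x11 x12 x21 x22 $ 1 $ 1 = x11" "mat2 x11 x12 x21 x22 $ 1 $ 2 = x12"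
  "mat2 x11 x12 x21 x22 $ 2 $ 1 = x21" "mat2 x11 x12 x21 x22 $ 2 $ 2 = x22"
  by (auto simp: mat2_def axis_def)

lemma mat2_eta: "mat2 (X$1$1) (X$1$2) (X$2$1) (X$2$2) = X"
  by (simp add: vec_eq_iff forall_2)

text \<open>The product of $\begin{pmatrix} 1 & -t \cr 0 & 1 \end{pmatrix}$,
  $\begin{pmatrix} u & 0 \cr a & w \end{pmatrix}$ and $\begin{pmatrix} 1 & s \cr 0 & 1 \end{pmatrix}$.\<close>

definition gmat :: "real \<Rightarrow> real \<Rightarrow> real \<Rightarrow> real \<Rightarrow> real \<Rightarrow> real^2^2" where
  "gmat t s u w a = mat2 (u - t * a) (u * s - t * (w + s * a)) a (w + s * a)"

lemma det_gmat: "det (gmat t s u w a) = u * w"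
  by (simp add: gmat_def det_2 algebra_simps)

lemma GL2_eq: "GL2 = {X. det X \<noteq> 0}"
  by (simp add: GL2_def invertible_det_nz)

lemma continuous_on_det2: "continuous_on S (det :: real^2^2 \<Rightarrow> real)"
  unfolding det_2[abs_def] by (intro continuous_intros)

lemma open_GL2: "open GL2"
  unfolding GL2_eq by (intro open_Collect_neq continuous_on_det2 continuous_intros)

lemma Basis_mat2:
  "(Basis :: (real^2^2) set) = {axis 1 (axis 1 1), axis 1 (axis 2 1), axis 2 (axis 1 1), axis 2 (axis 2 1)}"
  unfolding Basis_vec_def by (auto simp: UNIV_2)

lemma axis_mat2_distinct:
  "axis 1 (axis 1 1) \<noteq> (axis 1 (axis 2 1) :: real^2^2)"
  "axis 1 (axis 1 1) \<noteq> (axis 2 (axis 1 1) :: real^2^2)"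
  "axis 1 (axis 1 1) \<noteq> (axis 2 (axis 2 1) :: real^2^2)"
  "axis 1 (axis 2 1) \<noteq> (axis 2 (axis 1 1) :: real^2^2)"
  "axis 1 (axis 2 1) \<noteq> (axis 2 (axis 2 1) :: real^2^2)"
  "axis 2 (axis 1 1) \<noteq> (axis 2 (axis 2 1) :: real^2^2)"
  by (auto simp: axis_eq_axis)

lemma continuous_on_mat2 [continuous_intros]:
  assumes "continuous_on S f11" "continuous_on S f12" "continuous_on S f21" "continuous_on S f22"
  shows "continuous_on S (\<lambda>x. mat2 (f11 x) (f12 x) (f21 x) (f22 x))"
  unfolding mat2_def by (intro continuous_intros assms)

lemma continuous_on_gmat [continuous_intros]:
  assumes "continuous_on S t" "continuous_on S s" "continuous_on S u" "continuous_on S w" "continuous_on S a"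
  shows "continuous_on S (\<lambda>x. gmat (t x) (s x) (u x) (w x) (a x))"
  unfolding gmat_def by (intro continuous_intros assms)

lemma nn_integral_translate:
  fixes f :: "real \<Rightarrow> ennreal"
  assumes "f \<in> borel_measurable borel"
  shows "(\<integral>\<^sup>+x. f (x + c) \<partial>lborel) = (\<integral>\<^sup>+x. f x \<partial>lborel)"
  using nn_integral_real_affine[OF assms, of 1 c] by (simp add: add.commute)

lemma nn_integral_lborel_Pair:
  fixes f :: "'a::euclidean_space \<times> 'b::euclidean_space \<Rightarrow> ennreal"
  assumes "f \<in> borel_measurable borel"
  shows "(\<integral>\<^sup>+p. f p \<partial>lborel) = (\<integral>\<^sup>+x. \<integral>\<^sup>+y. f (x, y) \<partial>lborel \<partial>lborel)"
proof -
  have "f \<in> borel_measurable (lborel \<Otimes>\<^sub>M lborel)"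
    using assms by (simp add: lborel_prod)
  from lborel.nn_integral_fst[OF this] show ?thesis by (simp add: lborel_prod)
qed

lemma measurable_Pair1_borel:
  fixes f :: "'a::euclidean_space \<times> 'b::euclidean_space \<Rightarrow> 'c::topological_space"
  assumes "f \<in> borel_measurable borel"
  shows "(\<lambda>y. f (x, y)) \<in> borel_measurable borel"
  by (rule measurable_compose[OF _ assms]) (intro borel_measurable_continuous_onI continuous_intros)

lemma nn_integral_lborel_R4:
  fixes f :: "real \<times> real \<times> real \<times> real \<Rightarrow> ennreal"
  assumes "f \<in> borel_measurable borel"
  shows "(\<integral>\<^sup>+p. f p \<partial>lborel) =
    (\<integral>\<^sup>+x. \<integral>\<^sup>+y. \<integral>\<^sup>+z. \<integral>\<^sup>+w. f (x, y, z, w) \<partial>lborel \<partial>lborel \<partial>lborel \<partial>lborel)"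
  using assms by (simp add: nn_integral_lborel_Pair measurable_Pair1_borel)

text \<open>Lebesgue measure is determined by the volumes of boxes. For a box, the change of variables can be
  carried out one coordinate at a time: $b = w + sa$ is a translation in \<open>w\<close>, then $x_{12} = us - tb$
  is affine in \<open>s\<close> with slope \<open>u\<close>, which uses up the density, and $x_{11} = u - ta$ is a translation
  in \<open>u\<close>.\<close>

lemma lborel_eq_distr_gmat:
  "(lborel :: (real^2^2) measure) =
     distr (density lborel (\<lambda>(s, u, w, a). ennreal \<bar>u\<bar>)) borel (\<lambda>(s, u, w, a). gmat t s u w a)"
proof (rule lborel_eqI)
  fix l h :: "real^2^2"
  assume le: "\<And>b. b \<in> Basis \<Longrightarrow> l \<bullet> b \<le> h \<bullet> b"
  define I where "I p q = {l$p$q<..<h$p$q}" for p q :: 2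
  have leI: "l$p$q \<le> h$p$q" for p q
    using le[of "axis p (axis q 1)"] by (auto simp: inner_axis Basis_vec_def)
  have gm [measurable]: "(\<lambda>(s, u, w, a). gmat t s u w a) \<in> borel_measurable borel"
    unfolding split_beta by (intro borel_measurable_continuous_onI continuous_intros)
  have dm [measurable]: "(\<lambda>(s, u, w, a). ennreal \<bar>u\<bar>) \<in> borel_measurable (borel :: (real \<times> real \<times> real \<times> real) measure)"
    unfolding split_beta
    by (intro measurable_compose[OF _ measurable_ennreal] borel_measurable_continuous_onI continuous_intros)
  have box: "X \<in> box l h \<longleftrightarrow> X$1$1 \<in> I 1 1 \<and> X$1$2 \<in> I 1 2 \<and> X$2$1 \<in> I 2 1 \<and> X$2$2 \<in> I 2 2" for X
    unfolding mem_box Basis_mat2 I_def by (simp add: inner_axis)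
  have [measurable]: "I p q \<in> sets borel" for p q by (simp add: I_def)
  have eI: "(\<integral>\<^sup>+x. indicator (I p q) x \<partial>lborel) = ennreal (h$p$q - l$p$q)" for p q
    using leI by (simp add: I_def)
  have "emeasure (distr (density lborel (\<lambda>(s, u, w, a). ennreal \<bar>u\<bar>)) borel (\<lambda>(s, u, w, a). gmat t s u w a)) (box l h)
     = (\<integral>\<^sup>+y. (case y of (s, u, w, a) \<Rightarrow> ennreal \<bar>u\<bar> * indicator (box l h) (gmat t s u w a)) \<partial>lborel)"
    apply (subst emeasure_distr)
      apply simp
     apply simp
    apply (subst emeasure_density)
      apply simp
     apply (simp add: measurable_sets_borel[OF gm])
    apply (intro nn_integral_cong)
    apply (auto simp: indicator_def split: prod.splits)
    done
  also have "\<dots> = (\<integral>\<^sup>+s. \<integral>\<^sup>+u. \<integral>\<^sup>+w. \<integral>\<^sup>+a. ennreal \<bar>u\<bar> * indicator (box l h) (gmat t s u w a)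
       \<partial>lborel \<partial>lborel \<partial>lborel \<partial>lborel)"
  proof (subst nn_integral_lborel_R4)
    have "(\<lambda>y. (case y of (s, u, w, a) \<Rightarrow> ennreal \<bar>u\<bar>) * indicator (box l h) (case y of (s, u, w, a) \<Rightarrow> gmat t s u w a))
       \<in> borel_measurable borel"
      by measurable
    then show "(\<lambda>y. case y of (s, u, w, a) \<Rightarrow> ennreal \<bar>u\<bar> * indicator (box l h) (gmat t s u w a)) \<in> borel_measurable borel"
      by (simp add: split_beta')
  qed simp
  also have "\<dots> = (\<integral>\<^sup>+s. \<integral>\<^sup>+u. \<integral>\<^sup>+w. \<integral>\<^sup>+a. ennreal \<bar>u\<bar> * (indicator (I 1 1) (u - t * a)
       * (indicator (I 1 2) (u * s - t * (w + s * a)) * (indicator (I 2 1) a * indicator (I 2 2) (w + s * a))))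
       \<partial>lborel \<partial>lborel \<partial>lborel \<partial>lborel)"
    by (intro nn_integral_cong) (simp add: gmat_def box indicator_def)
  also have "\<dots> = (\<integral>\<^sup>+s. \<integral>\<^sup>+u. \<integral>\<^sup>+a. \<integral>\<^sup>+w. ennreal \<bar>u\<bar> * (indicator (I 1 1) (u - t * a)
       * (indicator (I 1 2) (u * s - t * (w + s * a)) * (indicator (I 2 1) a * indicator (I 2 2) (w + s * a))))
       \<partial>lborel \<partial>lborel \<partial>lborel \<partial>lborel)"
    by (rule nn_integral_cong, rule nn_integral_cong, rule lborel_pair.Fubini') measurable
  also have "\<dots> = (\<integral>\<^sup>+s. \<integral>\<^sup>+u. \<integral>\<^sup>+a. \<integral>\<^sup>+b. ennreal \<bar>u\<bar> * (indicator (I 1 1) (u - t * a)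
       * (indicator (I 1 2) (u * s - t * b) * (indicator (I 2 1) a * indicator (I 2 2) b)))
       \<partial>lborel \<partial>lborel \<partial>lborel \<partial>lborel)"
    by (rule nn_integral_cong, rule nn_integral_cong, rule nn_integral_cong,
        rule nn_integral_translate[where f="\<lambda>b. ennreal \<bar>_\<bar> * (indicator (I 1 1) (_ - t * _)
       * (indicator (I 1 2) (_ - t * b) * (indicator (I 2 1) _ * indicator (I 2 2) b)))"]) measurable
  also have "\<dots> = (\<integral>\<^sup>+u. \<integral>\<^sup>+s. \<integral>\<^sup>+a. \<integral>\<^sup>+b. ennreal \<bar>u\<bar> * (indicator (I 1 1) (u - t * a)
       * (indicator (I 1 2) (u * s - t * b) * (indicator (I 2 1) a * indicator (I 2 2) b)))
       \<partial>lborel \<partial>lborel \<partial>lborel \<partial>lborel)"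
    by (rule lborel_pair.Fubini') measurable
  also have "\<dots> = (\<integral>\<^sup>+u. \<integral>\<^sup>+a. \<integral>\<^sup>+s. \<integral>\<^sup>+b. ennreal \<bar>u\<bar> * (indicator (I 1 1) (u - t * a)
       * (indicator (I 1 2) (u * s - t * b) * (indicator (I 2 1) a * indicator (I 2 2) b)))
       \<partial>lborel \<partial>lborel \<partial>lborel \<partial>lborel)"
    by (rule nn_integral_cong, rule lborel_pair.Fubini') measurable
  also have "\<dots> = (\<integral>\<^sup>+u. \<integral>\<^sup>+a. \<integral>\<^sup>+b. \<integral>\<^sup>+s. ennreal \<bar>u\<bar> * (indicator (I 1 1) (u - t * a)
       * (indicator (I 1 2) (u * s - t * b) * (indicator (I 2 1) a * indicator (I 2 2) b)))
       \<partial>lborel \<partial>lborel \<partial>lborel \<partial>lborel)"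
    by (rule nn_integral_cong, rule nn_integral_cong, rule lborel_pair.Fubini') measurable
  also have "\<dots> = (\<integral>\<^sup>+u. \<integral>\<^sup>+a. \<integral>\<^sup>+b. indicator (I 1 1) (u - t * a)
       * (indicator (I 2 1) a * indicator (I 2 2) b) * ennreal (h$1$2 - l$1$2)
       \<partial>lborel \<partial>lborel \<partial>lborel)"
  proof (rule nn_integral_cong_AE, rule AE_mp[OF AE_lborel_singleton[of "0::real"]], rule AE_I2, rule impI,
      rule nn_integral_cong, rule nn_integral_cong)
    fix u a b :: real assume "u \<noteq> 0"
    have "ennreal (h$1$2 - l$1$2) = ennreal \<bar>u\<bar> * (\<integral>\<^sup>+s. indicator (I 1 2) (- t * b + u * s) \<partial>lborel)"
      using nn_integral_real_affine[of "indicator (I 1 2)" u "- t * b"] \<open>u \<noteq> 0\<close> eI[of 1 2] by simp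
    then show "(\<integral>\<^sup>+s. ennreal \<bar>u\<bar> * (indicator (I 1 1) (u - t * a)
       * (indicator (I 1 2) (u * s - t * b) * (indicator (I 2 1) a * indicator (I 2 2) b))) \<partial>lborel)
       = indicator (I 1 1) (u - t * a) * (indicator (I 2 1) a * indicator (I 2 2) b) * ennreal (h$1$2 - l$1$2)"
      by (simp add: nn_integral_cmult nn_integral_multc mult_ac)
  qed
  also have "\<dots> = (\<integral>\<^sup>+a. \<integral>\<^sup>+u. \<integral>\<^sup>+b. indicator (I 1 1) (u - t * a)
       * (indicator (I 2 1) a * indicator (I 2 2) b) * ennreal (h$1$2 - l$1$2)
       \<partial>lborel \<partial>lborel \<partial>lborel)"
    by (rule lborel_pair.Fubini') measurable
  also have "\<dots> = (\<integral>\<^sup>+a. \<integral>\<^sup>+u. indicator (I 1 1) (u + (- t * a))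
       * (indicator (I 2 1) a * ennreal (h$2$2 - l$2$2)) * ennreal (h$1$2 - l$1$2)
       \<partial>lborel \<partial>lborel)"
    by (rule nn_integral_cong, rule nn_integral_cong) (simp add: nn_integral_cmult nn_integral_multc eI mult.assoc)
  also have "\<dots> = (\<integral>\<^sup>+a. \<integral>\<^sup>+u. indicator (I 1 1) u
       * (indicator (I 2 1) a * ennreal (h$2$2 - l$2$2)) * ennreal (h$1$2 - l$1$2)
       \<partial>lborel \<partial>lborel)"
    by (rule nn_integral_cong, rule nn_integral_translate[where f="\<lambda>u. indicator (I 1 1) u * _ * _"]) measurable
  also have "\<dots> = ennreal (h$1$1 - l$1$1) * (ennreal (h$2$1 - l$2$1) * ennreal (h$2$2 - l$2$2)) * ennreal (h$1$2 - l$1$2)"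
    by (simp add: nn_integral_cmult nn_integral_multc eI mult.assoc)
  also have "\<dots> = ennreal (\<Prod>b\<in>Basis. (h - l) \<bullet> b)"
    using leI by (simp add: Basis_mat2 axis_mat2_distinct inner_axis ennreal_mult[symmetric] mult_ac)
  finally show "emeasure (distr (density lborel (\<lambda>(s, u, w, a). ennreal \<bar>u\<bar>)) borel (\<lambda>(s, u, w, a). gmat t s u w a)) (box l h)
     = ennreal (\<Prod>b\<in>Basis. (h - l) \<bullet> b)" .
qed simp

section \<open>Continuous functions with compact support in the group\<close>

text \<open>Continuous with compact support in the open set of invertible matrices. This weakening of
  \<^const>\<open>test_functions\<close> is satisfied by a test function, its first derivatives and its images under
  \<^const>\<open>e_op\<close>, and it suffices for the existence of the kernel.\<close>

definition cc_GL2 :: "(real^2^2 \<Rightarrow> complex) \<Rightarrow> bool" where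
  "cc_GL2 \<Phi> \<longleftrightarrow> continuous_on UNIV \<Phi> \<and> (\<exists>C. compact C \<and> C \<subseteq> GL2 \<and> (\<forall>X. X \<notin> C \<longrightarrow> \<Phi> X = 0))"

lemma cc_GL2_mult:
  assumes "cc_GL2 \<Phi>" "continuous_on GL2 g"
  shows "cc_GL2 (\<lambda>X. g X * \<Phi> X)"
proof -
  obtain C where C: "compact C" "C \<subseteq> GL2" "\<And>X. X \<notin> C \<Longrightarrow> \<Phi> X = 0"
    using assms(1) by (auto simp: cc_GL2_def)
  have "continuous_on (GL2 \<union> - C) (\<lambda>X. g X * \<Phi> X)"
  proof (rule continuous_on_open_Un)
    show "continuous_on GL2 (\<lambda>X. g X * \<Phi> X)"
      using assms by (auto simp: cc_GL2_def intro!: continuous_intros intro: continuous_on_subset)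
    show "continuous_on (- C) (\<lambda>X. g X * \<Phi> X)"
      using C(3) by (subst continuous_on_cong[OF refl, where g="\<lambda>_. 0"]) auto
  qed (use C open_GL2 in \<open>auto intro: compact_imp_closed\<close>)
  moreover have "GL2 \<union> - C = UNIV" using C by auto
  ultimately have "continuous_on UNIV (\<lambda>X. g X * \<Phi> X)" by simp
  moreover have "\<forall>X. X \<notin> C \<longrightarrow> g X * \<Phi> X = 0" using C(3) by simp
  ultimately show ?thesis using C(1,2) unfolding cc_GL2_def by blast
qed

lemma cc_GL2_add:
  assumes "cc_GL2 \<Phi>" "cc_GL2 \<Psi>"
  shows "cc_GL2 (\<lambda>X. \<Phi> X + \<Psi> X)"
proof -
  obtain C where C: "compact C" "C \<subseteq> GL2" "\<And>X. X \<notin> C \<Longrightarrow> \<Phi> X = 0"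
    using assms(1) by (auto simp: cc_GL2_def)
  obtain D where D: "compact D" "D \<subseteq> GL2" "\<And>X. X \<notin> D \<Longrightarrow> \<Psi> X = 0"
    using assms(2) by (auto simp: cc_GL2_def)
  have "compact (C \<union> D)" "C \<union> D \<subseteq> GL2" "\<And>X. X \<notin> C \<union> D \<Longrightarrow> \<Phi> X + \<Psi> X = 0"
    using C D by auto
  moreover have "continuous_on UNIV (\<lambda>X. \<Phi> X + \<Psi> X)"
    using assms by (auto simp: cc_GL2_def intro!: continuous_intros)
  ultimately show ?thesis unfolding cc_GL2_def by blast
qed

lemma cc_GL2_singular:
  assumes "cc_GL2 \<Phi>" "u * w = 0"
  shows "\<Phi> (gmat t s u w a) = 0"
proof -
  have "gmat t s u w a \<notin> GL2" using assms(2) by (simp add: GL2_eq det_gmat)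
  then show ?thesis using assms(1) by (meson cc_GL2_def subsetD)
qed

text \<open>The weight may be singular where $uw = 0$, but there the matrix is singular and the function
  vanishes in a neighbourhood.\<close>

lemma continuous_on_weighted:
  fixes t s u w a :: "'p::topological_space \<Rightarrow> real"
  assumes "cc_GL2 \<Phi>" and c: "continuous_on UNIV t" "continuous_on UNIV s" "continuous_on UNIV u"
    "continuous_on UNIV w" "continuous_on UNIV a" and g: "continuous_on {p. u p * w p \<noteq> 0} g"
  shows "continuous_on UNIV (\<lambda>p. \<Phi> (gmat (t p) (s p) (u p) (w p) (a p)) * g p)" (is "continuous_on _ ?f")
proof -
  obtain C where C: "compact C" "C \<subseteq> GL2" "\<And>X. X \<notin> C \<Longrightarrow> \<Phi> X = 0"
    using assms(1) by (auto simp: cc_GL2_def)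
  let ?m = "\<lambda>p. gmat (t p) (s p) (u p) (w p) (a p)"
  note c' = c[THEN continuous_on_subset, OF subset_UNIV]
  have m: "continuous_on S ?m" for S
    by (intro continuous_on_gmat c')
  have \<Phi>m: "continuous_on S (\<lambda>p. \<Phi> (?m p))" for S
    using assms(1) by (intro continuous_on_compose2[OF _ m[of S]]) (auto simp: cc_GL2_def)
  have "continuous_on ({p. u p * w p \<noteq> 0} \<union> ?m -` (- C)) ?f"
  proof (rule continuous_on_open_Un)
    show "open {p. u p * w p \<noteq> 0}"
      by (intro open_Collect_neq continuous_intros c)
    show "open (?m -` (- C))"
      using m C(1) by (intro open_vimage) (auto intro: compact_imp_closed)
    show "continuous_on {p. u p * w p \<noteq> 0} ?f"
      by (rule continuous_on_mult[OF \<Phi>m g])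
    show "continuous_on (?m -` (- C)) ?f"
      using C(3) by (subst continuous_on_cong[OF refl, where g="\<lambda>_. 0"]) auto
  qed
  moreover have "{p. u p * w p \<noteq> 0} \<union> ?m -` (- C) = UNIV"
    using C(2) by (auto simp: GL2_eq subset_iff) (metis det_gmat mult_eq_0_iff)+
  ultimately show ?thesis by simp
qed

text \<open>For bounded \<open>t\<close> and \<open>s\<close> the factorisation can be inverted with bounds: $u = x_{11} + t x_{21}$,
  $a = x_{21}$, $w = x_{22} - s x_{21}$.\<close>

lemma gmat_support_bound:
  assumes "cc_GL2 \<Phi>"
  obtains B where "B \<ge> 0" "\<And>t s u w a. \<bar>t\<bar> \<le> R \<Longrightarrow> \<bar>s\<bar> \<le> R \<Longrightarrow> \<Phi> (gmat t s u w a) \<noteq> 0 \<Longrightarrow>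
    \<bar>u\<bar> \<le> B \<and> \<bar>w\<bar> \<le> B \<and> \<bar>a\<bar> \<le> B"
proof -
  obtain C where C: "compact C" "C \<subseteq> GL2" "\<And>X. X \<notin> C \<Longrightarrow> \<Phi> X = 0"
    using assms(1) by (auto simp: cc_GL2_def)
  obtain M where M: "\<And>X. X \<in> C \<Longrightarrow> norm X \<le> M"
    using compact_imp_bounded[OF C(1)] by (auto simp: bounded_iff)
  have ent: "\<bar>X$p$q\<bar> \<le> max M 0" if "X \<in> C" for X :: "real^2^2" and p q
  proof -
    have "\<bar>X$p$q\<bar> \<le> norm (X$p)" by (rule component_le_norm_cart)
    also have "\<dots> \<le> norm X" by (rule Finite_Cartesian_Product.norm_nth_le)
    also have "\<dots> \<le> M" by (rule M[OF that])
    finally show ?thesis by simp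
  qed
  define B where "B = max M 0 + max R 0 * max M 0"
  show thesis
  proof
    show "B \<ge> 0" by (simp add: B_def)
    fix t s u w a :: real assume ts: "\<bar>t\<bar> \<le> R" "\<bar>s\<bar> \<le> R" and nz: "\<Phi> (gmat t s u w a) \<noteq> 0"
    then have X: "gmat t s u w a \<in> C" using C(3) by blast
    from ent[OF X, of 1 1] ent[OF X, of 2 1] ent[OF X, of 2 2]
    have e: "\<bar>u - t * a\<bar> \<le> max M 0" "\<bar>a\<bar> \<le> max M 0" "\<bar>w + s * a\<bar> \<le> max M 0"
      by (auto simp: gmat_def)
    have "\<bar>t\<bar> * \<bar>a\<bar> \<le> max R 0 * max M 0" "\<bar>s\<bar> * \<bar>a\<bar> \<le> max R 0 * max M 0"
      using ts e(2) by (auto intro!: mult_mono)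
    then have "\<bar>t * a\<bar> \<le> max R 0 * max M 0" "\<bar>s * a\<bar> \<le> max R 0 * max M 0"
      by (auto simp: abs_mult)
    moreover have "0 \<le> max R 0 * max M 0" by simp
    ultimately show "\<bar>u\<bar> \<le> B \<and> \<bar>w\<bar> \<le> B \<and> \<bar>a\<bar> \<le> B"
      using e unfolding B_def by linarith
  qed
qed

lemma integral_lborel_compact_support:
  fixes f :: "'a::euclidean_space \<Rightarrow> complex"
  assumes "continuous_on UNIV f" "\<And>y. y \<notin> cbox c d \<Longrightarrow> f y = 0"
  shows "integrable lborel f" "(\<integral>y. f y \<partial>lborel) = integral (cbox c d) f"
proof -
  have f: "(\<lambda>x. indicator (cbox c d) x *\<^sub>R f x) = f"
    using assms(2) by (auto simp: indicator_def fun_eq_iff)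
  have i: "set_integrable lborel (cbox c d) f"
    unfolding set_integrable_def
    by (intro borel_integrable_compact compact_cbox continuous_on_subset[OF assms(1)]) auto
  then show "integrable lborel f" by (simp add: set_integrable_def f)
  show "(\<integral>y. f y \<partial>lborel) = integral (cbox c d) f"
    using set_borel_integral_eq_integral(2)[OF i] by (simp add: set_lebesgue_integral_def f)
qed

lemma has_vector_derivative_integral_compact_support:
  fixes f f' :: "real \<Rightarrow> 'a::euclidean_space \<Rightarrow> complex"
  assumes der: "\<And>h y. ((\<lambda>h. f h y) has_vector_derivative f' h y) (at h)"
    and cont: "\<And>h. continuous_on UNIV (f h)" "continuous_on UNIV (\<lambda>(h, y). f' h y)"
    and supp: "\<And>h y. \<bar>h\<bar> \<le> 1 \<Longrightarrow> y \<notin> cbox c d \<Longrightarrow> f h y = 0 \<and> f' h y = 0"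
  shows "((\<lambda>h. \<integral>y. f h y \<partial>lborel) has_vector_derivative (\<integral>y. f' 0 y \<partial>lborel)) (at 0)"
proof -
  have c': "continuous_on UNIV (f' h)" for h
  proof -
    have "continuous_on UNIV (\<lambda>y. case (h, y) of (h, y) \<Rightarrow> f' h y)"
      by (rule continuous_on_compose2[OF cont(2)]) (auto intro!: continuous_intros)
    then show ?thesis by simp
  qed
  have "((\<lambda>h. integral (cbox c d) (f h)) has_vector_derivative integral (cbox c d) (f' 0)) (at 0 within {-1<..<1})"
  proof (rule leibniz_rule_vector_derivative)
    show "((\<lambda>x. f x t) has_vector_derivative f' x t) (at x within {-1<..<1})" for x t
      using der by (rule has_vector_derivative_at_within)
    show "f x integrable_on cbox c d" for x
      by (intro integrable_continuous continuous_on_subset[OF cont(1)]) auto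
    show "continuous_on ({- 1<..<1} \<times> cbox c d) (\<lambda>(x, t). f' x t)"
      by (intro continuous_on_subset[OF cont(2)]) auto
  qed auto
  then have "((\<lambda>h. integral (cbox c d) (f h)) has_vector_derivative integral (cbox c d) (f' 0)) (at 0)"
    by (subst (asm) at_within_open) auto
  moreover have "(\<integral>y. f' 0 y \<partial>lborel) = integral (cbox c d) (f' 0)"
    using c' supp by (intro integral_lborel_compact_support(2)) auto
  moreover have eq: "(\<integral>y. f h y \<partial>lborel) = integral (cbox c d) (f h)" if "h \<in> {-1<..<1}" for h
    using cont(1) supp that by (intro integral_lborel_compact_support(2)) auto
  ultimately have "((\<lambda>h. integral (cbox c d) (f h)) has_vector_derivative (\<integral>y. f' 0 y \<partial>lborel)) (at 0)"
    by simp
  then show ?thesis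
    by (rule has_vector_derivative_transform_within_open[where S="{-1<..<1}"]) (simp_all add: eq)
qed

lemma integral_lborel_translate:
  fixes f :: "'a::euclidean_space \<Rightarrow> complex"
  assumes "continuous_on UNIV f"
  shows "(\<integral>y. f (y + v) \<partial>lborel) = (\<integral>y. f y \<partial>lborel)"
proof -
  have [measurable]: "f \<in> borel_measurable borel"
    using assms by (rule borel_measurable_continuous_onI)
  have "(\<integral>y. f y \<partial>lborel) = (\<integral>y. f y \<partial>distr lborel borel ((+) v))"
    by (simp add: lborel_distr_plus)
  also have "\<dots> = (\<integral>y. f (y + v) \<partial>lborel)"
    by (subst integral_distr) (auto simp: add.commute)
  finally show ?thesis by simp
qed

lemma continuous_on_integral_gmat:
  assumes "cc_GL2 \<Phi>" "continuous_on {(u, w, a). u * w \<noteq> (0::real)} g"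
  shows "continuous_on UNIV (\<lambda>(t, s). \<integral>(u, w, a). \<Phi> (gmat t s u w a) * g (u, w, a) \<partial>lborel)"
proof -
  let ?f = "\<lambda>(t, s) (u, w, a). \<Phi> (gmat t s u w a) * g (u, w, a)"
  have c: "continuous_on UNIV (\<lambda>p. \<Phi> (gmat (fst (fst p)) (snd (fst p)) (fst (snd p)) (fst (snd (snd p))) (snd (snd (snd p)))) * g (snd p))"
    by (rule continuous_on_weighted[OF assms(1)], (intro continuous_intros)+,
        rule continuous_on_compose2[OF assms(2)]) (auto intro!: continuous_intros)
  then have c: "continuous_on UNIV (\<lambda>(p, y). ?f p y)" by (simp add: split_beta)
  define J where "J p = (\<integral>y. ?f p y \<partial>lborel)" for p
  have "isCont J p" for p
  proof -
    define R where "R = max \<bar>fst p\<bar> \<bar>snd p\<bar> + 1"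
    obtain B where B: "\<And>t s u w a. \<bar>t\<bar> \<le> R \<Longrightarrow> \<bar>s\<bar> \<le> R \<Longrightarrow> \<Phi> (gmat t s u w a) \<noteq> 0 \<Longrightarrow>
        \<bar>u\<bar> \<le> B \<and> \<bar>w\<bar> \<le> B \<and> \<bar>a\<bar> \<le> B"
      by (rule gmat_support_bound[OF assms(1), of R]) blast
    define U where "U = {q. \<bar>fst q\<bar> < R \<and> \<bar>snd q\<bar> < R}"
    have U: "open U" unfolding U_def by (intro open_Collect_conj open_Collect_less continuous_intros)
    have pU: "p \<in> U" by (auto simp: U_def R_def)
    let ?b = "cbox (- B, - B, - B) (B, B, B)"
    have contI: "continuous_on U (\<lambda>p. integral ?b (?f p))"
      by (intro integral_continuous_on_param continuous_on_subset[OF c]) auto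
    have eqI: "J q = integral ?b (?f q)" if "q \<in> U" for q
      unfolding J_def
    proof (rule integral_lborel_compact_support(2))
      show "continuous_on UNIV (?f q)"
      proof -
        have "continuous_on UNIV (\<lambda>y. case (q, y) of (p, y) \<Rightarrow> ?f p y)"
          by (rule continuous_on_compose2[OF c]) (auto intro!: continuous_intros)
        then show ?thesis by simp
      qed
      show "?f q y = 0" if "y \<notin> ?b" for y
      proof (cases y)
        case (fields u w a)
        have "\<Phi> (gmat (fst q) (snd q) u w a) = 0"
        proof (rule ccontr)
          assume nz: "\<Phi> (gmat (fst q) (snd q) u w a) \<noteq> 0"
          have "\<bar>u\<bar> \<le> B \<and> \<bar>w\<bar> \<le> B \<and> \<bar>a\<bar> \<le> B"
            using \<open>q \<in> U\<close> by (intro B[OF _ _ nz]) (auto simp: U_def)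
          then show False using that by (auto simp: fields cbox_Pair_eq abs_le_iff)
        qed
        then show ?thesis by (simp add: fields split_beta)
      qed
    qed
    have "continuous_on U J"
      by (rule continuous_on_eq[OF contI]) (rule eqI[symmetric])
    then show ?thesis using U pU continuous_on_eq_continuous_at by blast
  qed
  then have "continuous_on UNIV J" by (simp add: continuous_on_eq_continuous_at)
  then show ?thesis by (simp add: J_def[abs_def] split_beta')
qed

lemma integrable_gmat:
  assumes "cc_GL2 \<Phi>" "continuous_on {(u, w, a). u * w \<noteq> (0::real)} g"
  shows "integrable lborel (\<lambda>(u, w, a). \<Phi> (gmat t s u w a) * g (u, w, a))"
proof -
  obtain B where "\<And>t' s' u w a. \<bar>t'\<bar> \<le> max \<bar>t\<bar> \<bar>s\<bar> \<Longrightarrow> \<bar>s'\<bar> \<le> max \<bar>t\<bar> \<bar>s\<bar> \<Longrightarrow>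
      \<Phi> (gmat t' s' u w a) \<noteq> 0 \<Longrightarrow> \<bar>u\<bar> \<le> B \<and> \<bar>w\<bar> \<le> B \<and> \<bar>a\<bar> \<le> B"
    by (rule gmat_support_bound[OF assms(1), of "max \<bar>t\<bar> \<bar>s\<bar>"]) blast
  from this[of t s] have B: "\<And>u w a. \<Phi> (gmat t s u w a) \<noteq> 0 \<Longrightarrow> \<bar>u\<bar> \<le> B \<and> \<bar>w\<bar> \<le> B \<and> \<bar>a\<bar> \<le> B"
    by simp
  show ?thesis
  proof (rule integral_lborel_compact_support(1))
    show "continuous_on UNIV (\<lambda>(u, w, a). \<Phi> (gmat t s u w a) * g (u, w, a))"
      unfolding split_beta
      by (rule continuous_on_weighted[OF assms(1)], (intro continuous_intros)+,
          rule continuous_on_compose2[OF assms(2)]) (auto intro!: continuous_intros)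
    show "(case y of (u, w, a) \<Rightarrow> \<Phi> (gmat t s u w a) * g (u, w, a)) = 0"
      if "y \<notin> cbox (- B, - B, - B) (B, B, B)" for y
    proof (cases y)
      case (fields u w a)
      have "\<Phi> (gmat t s u w a) = 0"
      proof (rule ccontr)
        assume "\<Phi> (gmat t s u w a) \<noteq> 0"
        from B[OF this] show False using that by (auto simp: fields cbox_Pair_eq abs_le_iff)
      qed
      then show ?thesis by (simp add: fields)
    qed
  qed
qed

lemma test_function_C1:
  assumes "F \<in> test_functions"
  shows "\<exists>F'. (\<forall>X. (F has_derivative F' X) (at X)) \<and> (\<forall>V. cc_GL2 (\<lambda>X. F' X V)) \<and> cc_GL2 F"
proof -
  define C where "C = closure {X. F X \<noteq> 0}"
  have C: "compact C" "C \<subseteq> GL2" "\<And>X. X \<notin> C \<Longrightarrow> F X = 0"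
    using assms closure_subset[of "{X. F X \<noteq> 0}"] by (auto simp: test_functions_def C_def)
  have "Ck_on (Suc 0) GL2 F"
    using assms unfolding test_functions_def smooth_on_def by blast
  then obtain G where G: "\<And>X. X \<in> GL2 \<Longrightarrow> (F has_derivative G X) (at X)" "\<And>V. continuous_on GL2 (\<lambda>X. G X V)"
    by auto
  define F' where "F' X = (if X \<in> C then G X else (\<lambda>_. 0))" for X
  have op: "open (- C)" using C(1) by (simp add: compact_imp_closed open_Compl)
  have zero: "(F has_derivative (\<lambda>_. 0)) (at X)" if "X \<notin> C" for X
  proof -
    have "((\<lambda>_. 0::complex) has_derivative (\<lambda>_. 0)) (at X)" by simp
    then show ?thesis
      by (rule has_derivative_transform_within_open[OF _ op]) (use that C(3) in auto)
  qed
  have der: "(F has_derivative F' X) (at X)" for X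
    using zero G(1) C(2) by (auto simp: F'_def)
  have F'G: "F' X = G X" if "X \<in> GL2" for X
    using has_derivative_unique[OF der G(1)[OF that]] .
  have "cc_GL2 (\<lambda>X. F' X V)" for V
  proof -
    have "continuous_on (GL2 \<union> - C) (\<lambda>X. F' X V)"
    proof (rule continuous_on_open_Un)
      show "continuous_on GL2 (\<lambda>X. F' X V)"
        using G(2) by (subst continuous_on_cong[OF refl, where g="\<lambda>X. G X V"]) (auto simp: F'G)
      show "continuous_on (- C) (\<lambda>X. F' X V)"
        by (subst continuous_on_cong[OF refl, where g="\<lambda>X. 0"]) (auto simp: F'_def)
    qed (use op open_GL2 in auto)
    moreover have "GL2 \<union> - C = UNIV" using C by auto
    ultimately have "continuous_on UNIV (\<lambda>X. F' X V)" by simp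
    moreover have "\<forall>X. X \<notin> C \<longrightarrow> F' X V = 0" by (simp add: F'_def)
    ultimately show ?thesis using C(1,2) unfolding cc_GL2_def by blast
  qed
  moreover have "cc_GL2 F"
  proof -
    have "continuous_on UNIV F"
      by (intro continuous_at_imp_continuous_on ballI has_derivative_continuous[OF der])
    then show ?thesis using C unfolding cc_GL2_def by blast
  qed
  ultimately have "(\<forall>X. (F has_derivative F' X) (at X)) \<and> (\<forall>V. cc_GL2 (\<lambda>X. F' X V)) \<and> cc_GL2 F"
    using der by (intro conjI allI)
  then show ?thesis by (rule exI[where x=F'])
qed

section \<open>Differentiation under the integral and integration by parts\<close>

lemma spow_pos: "x > 0 \<Longrightarrow> spow x c \<epsilon> = of_real x powr c"
  by (simp add: spow_def)

lemma spow_neg: "x < 0 \<Longrightarrow> spow x c \<epsilon> = (if \<epsilon> = 0 then 1 else - 1) * of_real (- x) powr c"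
  by (simp add: spow_def)

lemma spow_0 [simp]: "spow 0 c \<epsilon> = 0"
  by (simp add: spow_def)

lemma has_vector_derivative_spow:
  assumes "x \<noteq> 0"
  shows "((\<lambda>x. spow x c \<epsilon>) has_vector_derivative c * spow x c \<epsilon> / of_real x) (at x)"
proof -
  have pos: "((\<lambda>x. complex_of_real x powr c) has_vector_derivative c * of_real x powr c / of_real x) (at x)"
    if "x > 0" for x
  proof -
    have "((\<lambda>z. z powr c) has_field_derivative c * of_real x powr (c - 1)) (at (of_real x))"
      using that by (intro has_field_derivative_powr) (auto simp: complex_nonpos_Reals_iff)
    moreover have "(complex_of_real has_vector_derivative 1) (at x)"
      using has_vector_derivative_of_real[OF DERIV_ident, of "at x"] by simp
    ultimately show ?thesis
      using field_vector_diff_chain_at[of complex_of_real 1 x "\<lambda>z. z powr c"] that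
      by (simp add: o_def powr_diff)
  qed
  show ?thesis
  proof (cases "x > 0")
    case True
    show ?thesis
      unfolding spow_pos[OF True]
      by (rule has_vector_derivative_transform_within_open[OF pos[OF True], where S="{0<..}"])
         (use True in \<open>auto simp: spow_pos\<close>)
  next
    case False
    then have x: "x < 0" using assms by simp
    let ?k = "if \<epsilon> = 0 then 1 else - 1 :: complex"
    have "((\<lambda>x. complex_of_real (- x) powr c) has_vector_derivative
        - 1 *\<^sub>R (c * of_real (- x) powr c / of_real (- x))) (at x)"
      by (rule vector_diff_chain_at[of uminus "- 1" x "\<lambda>x. complex_of_real x powr c", unfolded o_def])
         (use pos[of "- x"] x in \<open>auto intro!: derivative_eq_intros\<close>)
    from has_vector_derivative_mult_right[OF this, of ?k]
    have "((\<lambda>x. ?k * complex_of_real (- x) powr c) has_vector_derivative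
        c * spow x c \<epsilon> / of_real x) (at x)"
      by (cases "\<epsilon> = 0") (simp_all add: spow_neg[OF x])
    then show ?thesis
      by (rule has_vector_derivative_transform_within_open[where S="{..<0}"])
         (use x in \<open>auto simp: spow_neg\<close>)
  qed
qed

lemma continuous_on_spow [continuous_intros]:
  assumes "continuous_on S f" "\<And>x. x \<in> S \<Longrightarrow> f x \<noteq> 0"
  shows "continuous_on S (\<lambda>x. spow (f x) c \<epsilon>)"
proof -
  have "continuous_on {x. x \<noteq> 0} (\<lambda>x. spow x c \<epsilon>)"
    by (intro continuous_at_imp_continuous_on ballI)
       (auto intro: has_vector_derivative_continuous has_vector_derivative_spow)
  then show ?thesis
    by (rule continuous_on_compose2[OF _ assms(1)]) (use assms(2) in auto)
qed

text \<open>These two lemmas are the reason why a shift of $\mu_i$ by $\pm1$ is accompanied by a change of parity: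
  together they amount to multiplication of the weight by \<open>x\<close> or $1/x$.\<close>

lemma spow_Suc: "spow x (c + 1) (\<epsilon> + 1) = of_real x * spow x c \<epsilon>"
proof -
  consider "x > 0" | "x < 0" | "x = 0" by linarith
  then show ?thesis
    by cases (cases \<epsilon>; simp add: spow_pos spow_neg powr_add)+
qed

lemma spow_pred: "spow x (c - 1) (\<epsilon> + 1) = spow x c \<epsilon> / of_real x"
  using spow_Suc[of x "c - 1" "\<epsilon> + 1"] by (cases "x = 0") (auto simp: add.assoc)

definition wt :: "complex \<Rightarrow> bit \<Rightarrow> complex \<Rightarrow> bit \<Rightarrow> nat \<Rightarrow> real \<times> real \<times> real \<Rightarrow> complex" where
  "wt p \<epsilon> q \<delta> n = (\<lambda>(u, w, a). spow u p \<epsilon> * spow w q \<delta> * of_real a ^ n)"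

definition dwt :: "complex \<Rightarrow> bit \<Rightarrow> complex \<Rightarrow> bit \<Rightarrow> nat \<Rightarrow> real \<Rightarrow> real \<Rightarrow> real \<Rightarrow> real \<times> real \<times> real \<Rightarrow> complex" where
  "dwt p \<epsilon> q \<delta> n \<upsilon> \<omega> \<alpha> = (\<lambda>(u, w, a).
     (p * of_real \<upsilon> / of_real u + q * of_real \<omega> / of_real w) * wt p \<epsilon> q \<delta> n (u, w, a)
     + of_nat n * of_real \<alpha> * wt p \<epsilon> q \<delta> (n - 1) (u, w, a))"

lemma has_vector_derivative_wt:
  assumes "u + h * \<upsilon> \<noteq> 0" "w + h * \<omega> \<noteq> 0"
  shows "((\<lambda>h. wt p \<epsilon> q \<delta> n (u + h * \<upsilon>, w + h * \<omega>, a + h * \<alpha>)) has_vector_derivative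
     dwt p \<epsilon> q \<delta> n \<upsilon> \<omega> \<alpha> (u + h * \<upsilon>, w + h * \<omega>, a + h * \<alpha>)) (at h)"
proof -
  have S: "((\<lambda>h. spow (x + h * \<xi>) c \<epsilon>) has_vector_derivative
      \<xi> *\<^sub>R (c * spow (x + h * \<xi>) c \<epsilon> / of_real (x + h * \<xi>))) (at h)" if "x + h * \<xi> \<noteq> 0" for x \<xi> c \<epsilon>
  proof -
    have "((\<lambda>h. x + h * \<xi>) has_vector_derivative \<xi>) (at h)"
      by (auto intro!: derivative_eq_intros)
    from vector_diff_chain_at[OF this has_vector_derivative_spow[OF that]] show ?thesis
      by (simp only: o_def)
  qed
  have P: "((\<lambda>h. complex_of_real (a + h * \<alpha>) ^ n) has_vector_derivative
      of_nat n * of_real \<alpha> * of_real (a + h * \<alpha>) ^ (n - 1)) (at h)"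
  proof -
    have "((\<lambda>h. (a + h * \<alpha>) ^ n) has_real_derivative real n * \<alpha> * (a + h * \<alpha>) ^ (n - 1)) (at h)"
      by (auto intro!: derivative_eq_intros)
    from has_vector_derivative_of_real[OF this, where 'a=complex] show ?thesis by simp
  qed
  note D = has_vector_derivative_mult[OF has_vector_derivative_mult[OF S[OF assms(1)] S[OF assms(2)]] P]
  show ?thesis
    unfolding wt_def prod.case
    by (rule has_vector_derivative_eq_rhs[OF D]) (simp add: dwt_def wt_def scaleR_conv_of_real algebra_simps)
qed

lemma continuous_on_wt:
  "continuous_on {(u, w, a). u * w \<noteq> 0} (wt p \<epsilon> q \<delta> n)"
  unfolding wt_def split_beta' by (intro continuous_intros) auto

lemma continuous_on_dwt:
  "continuous_on {(u, w, a). u * w \<noteq> 0} (dwt p \<epsilon> q \<delta> n \<upsilon> \<omega> \<alpha>)"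
  unfolding dwt_def wt_def split_beta' by (intro continuous_intros) auto

lemma has_vector_derivative_at_shift:
  assumes "((\<lambda>h. f (x + h)) has_vector_derivative D) (at 0)"
  shows "(f has_vector_derivative D) (at x)"
proof -
  have "((\<lambda>y. y - x) has_vector_derivative 1) (at x)"
    by (auto intro!: derivative_eq_intros)
  from vector_diff_chain_at[OF this, of "\<lambda>h. f (x + h)" D] assms show ?thesis
    by (simp add: o_def)
qed

definition kint :: "(real^2^2 \<Rightarrow> complex) \<Rightarrow> complex \<Rightarrow> bit \<Rightarrow> complex \<Rightarrow> bit \<Rightarrow> nat \<Rightarrow> real \<Rightarrow> real \<Rightarrow> complex" where
  "kint \<Phi> p \<epsilon> q \<delta> n t s = (\<integral>(u, w, a). \<Phi> (gmat t s u w a) * wt p \<epsilon> q \<delta> n (u, w, a) \<partial>lborel)"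

text \<open>The derivative of \<open>F\<close> is given by its partial derivatives, in order that the latter can be treated
  as functions of the same kind as \<open>F\<close>.\<close>

locale C1_GL2 =
  fixes F F11 F12 F21 F22 :: "real^2^2 \<Rightarrow> complex"
  assumes deriv: "\<And>X. (F has_derivative (\<lambda>V. of_real (V$1$1) * F11 X + of_real (V$1$2) * F12 X
       + of_real (V$2$1) * F21 X + of_real (V$2$2) * F22 X)) (at X)"
    and cc: "cc_GL2 F" "cc_GL2 F11" "cc_GL2 F12" "cc_GL2 F21" "cc_GL2 F22"
begin

text \<open>The derivative of the weighted integrand $F(X)\,\mathit{wt}$ in the direction
  $(\tau,\eta,\upsilon,\omega,\alpha)$ of the parameters $(t,s,u,w,a)$.\<close>

definition dint :: "complex \<Rightarrow> bit \<Rightarrow> complex \<Rightarrow> bit \<Rightarrow> nat \<Rightarrow> real \<Rightarrow> real \<Rightarrow> real \<Rightarrow> real \<Rightarrow> real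
    \<Rightarrow> real \<Rightarrow> real \<Rightarrow> real \<times> real \<times> real \<Rightarrow> complex" where
  "dint p \<epsilon> q \<delta> n \<tau> \<eta> \<upsilon> \<omega> \<alpha> t s = (\<lambda>(u, w, a).
     F11 (gmat t s u w a) * (of_real (\<upsilon> - \<tau> * a - t * \<alpha>) * wt p \<epsilon> q \<delta> n (u, w, a))
   + F12 (gmat t s u w a) * (of_real (\<upsilon> * s + u * \<eta> - \<tau> * (w + s * a) - t * (\<omega> + \<eta> * a + s * \<alpha>)) * wt p \<epsilon> q \<delta> n (u, w, a))
   + F21 (gmat t s u w a) * (of_real \<alpha> * wt p \<epsilon> q \<delta> n (u, w, a))
   + F22 (gmat t s u w a) * (of_real (\<omega> + \<eta> * a + s * \<alpha>) * wt p \<epsilon> q \<delta> n (u, w, a))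
   + F (gmat t s u w a) * dwt p \<epsilon> q \<delta> n \<upsilon> \<omega> \<alpha> (u, w, a))"

lemma has_vector_derivative_path:
  "((\<lambda>h. F (gmat (t + h * \<tau>) (s + h * \<eta>) (u + h * \<upsilon>) (w + h * \<omega>) (a + h * \<alpha>)) * wt p \<epsilon> q \<delta> n (u + h * \<upsilon>, w + h * \<omega>, a + h * \<alpha>))
     has_vector_derivative dint p \<epsilon> q \<delta> n \<tau> \<eta> \<upsilon> \<omega> \<alpha> (t + h * \<tau>) (s + h * \<eta>) (u + h * \<upsilon>, w + h * \<omega>, a + h * \<alpha>)) (at h)"
proof (cases "(u + h * \<upsilon>) * (w + h * \<omega>) = 0")
  case False
  define t' s' u' w' a' where d: "t' = t + h * \<tau>" "s' = s + h * \<eta>" "u' = u + h * \<upsilon>" "w' = w + h * \<omega>" "a' = a + h * \<alpha>"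
  define V where "V = mat2 (\<upsilon> - \<tau> * a' - t' * \<alpha>) (\<upsilon> * s' + u' * \<eta> - \<tau> * (w' + s' * a') - t' * (\<omega> + \<eta> * a' + s' * \<alpha>))
      \<alpha> (\<omega> + \<eta> * a' + s' * \<alpha>)"
  have "((\<lambda>h. gmat (t + h * \<tau>) (s + h * \<eta>) (u + h * \<upsilon>) (w + h * \<omega>) (a + h * \<alpha>)) has_vector_derivative V) (at h)"
    unfolding gmat_def mat2_def V_def d
    by (auto intro!: derivative_eq_intros simp: algebra_simps)
  from vector_derivative_diff_chain_within[OF this has_derivative_at_withinI[OF deriv], unfolded o_def]
  have "((\<lambda>h. F (gmat (t + h * \<tau>) (s + h * \<eta>) (u + h * \<upsilon>) (w + h * \<omega>) (a + h * \<alpha>))) has_vector_derivative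
      of_real (V$1$1) * F11 (gmat t' s' u' w' a') + of_real (V$1$2) * F12 (gmat t' s' u' w' a')
       + of_real (V$2$1) * F21 (gmat t' s' u' w' a') + of_real (V$2$2) * F22 (gmat t' s' u' w' a')) (at h)"
    by (simp add: d)
  from has_vector_derivative_mult[OF this has_vector_derivative_wt[of u h \<upsilon> w \<omega> p \<epsilon> q \<delta> n a \<alpha>]] False
  show ?thesis
    apply (simp flip: d)
    apply (erule has_vector_derivative_eq_rhs)
    apply (simp add: dint_def V_def algebra_simps)
    done
next
  case True
  note Z = cc[THEN cc_GL2_singular, OF True]
  obtain C where C: "compact C" "C \<subseteq> GL2" "\<And>X. X \<notin> C \<Longrightarrow> F X = 0"
    using cc(1) by (auto simp: cc_GL2_def)
  let ?m = "\<lambda>h. gmat (t + h * \<tau>) (s + h * \<eta>) (u + h * \<upsilon>) (w + h * \<omega>) (a + h * \<alpha>)"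
  have op: "open (?m -` (- C))"
    using C(1) by (intro open_vimage continuous_intros) (auto intro: compact_imp_closed)
  have "?m h \<notin> GL2" using True by (simp add: GL2_eq det_gmat)
  then have h: "h \<in> ?m -` (- C)" using C(2) by auto
  have "((\<lambda>h. 0) has_vector_derivative (0::complex)) (at h)" by simp
  then have "((\<lambda>h. F (?m h) * wt p \<epsilon> q \<delta> n (u + h * \<upsilon>, w + h * \<omega>, a + h * \<alpha>)) has_vector_derivative 0) (at h)"
    by (rule has_vector_derivative_transform_within_open[OF _ op h]) (use C(3) in auto)
  then show ?thesis by (simp add: dint_def Z)
qed

lemma dint_continuous:
  "continuous_on UNIV (\<lambda>(h, u, w, a). dint p \<epsilon> q \<delta> n \<tau> \<eta> \<upsilon> \<omega> \<alpha> (t + h * \<tau>) (s + h * \<eta>)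
     (u + h * \<upsilon>, w + h * \<omega>, a + h * \<alpha>))"
proof -
  have cw: "continuous_on {x. (fst (snd x) + fst x * \<upsilon>) * (fst (snd (snd x)) + fst x * \<omega>) \<noteq> 0}
     (\<lambda>x::real \<times> real \<times> real \<times> real. wt p \<epsilon> q \<delta> n (fst (snd x) + fst x * \<upsilon>, fst (snd (snd x)) + fst x * \<omega>, snd (snd (snd x)) + fst x * \<alpha>))"
    by (rule continuous_on_compose2[OF continuous_on_wt]) (auto intro!: continuous_intros)
  have cd: "continuous_on {x. (fst (snd x) + fst x * \<upsilon>) * (fst (snd (snd x)) + fst x * \<omega>) \<noteq> 0}
     (\<lambda>x::real \<times> real \<times> real \<times> real. dwt p \<epsilon> q \<delta> n \<upsilon> \<omega> \<alpha> (fst (snd x) + fst x * \<upsilon>, fst (snd (snd x)) + fst x * \<omega>, snd (snd (snd x)) + fst x * \<alpha>))"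
    by (rule continuous_on_compose2[OF continuous_on_dwt]) (auto intro!: continuous_intros)
  show ?thesis
    unfolding dint_def split_beta' fst_conv snd_conv
    apply (intro continuous_on_add)
        apply (rule continuous_on_weighted[OF cc(2)]; intro continuous_intros cw)
       apply (rule continuous_on_weighted[OF cc(3)]; intro continuous_intros cw)
      apply (rule continuous_on_weighted[OF cc(4)]; intro continuous_intros cw)
     apply (rule continuous_on_weighted[OF cc(5)]; intro continuous_intros cw)
    apply (rule continuous_on_weighted[OF cc(1)]; intro continuous_intros cd)
    done
qed

lemma path_support:
  obtains c d :: "real \<times> real \<times> real" where
    "\<And>h u w a. \<bar>h\<bar> \<le> 1 \<Longrightarrow> (u, w, a) \<notin> cbox c d \<Longrightarrow>
       F (gmat (t + h * \<tau>) (s + h * \<eta>) (u + h * \<upsilon>) (w + h * \<omega>) (a + h * \<alpha>)) = 0 \<and>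
       dint p \<epsilon> q \<delta> n \<tau> \<eta> \<upsilon> \<omega> \<alpha> (t + h * \<tau>) (s + h * \<eta>) (u + h * \<upsilon>, w + h * \<omega>, a + h * \<alpha>) = 0"
proof -
  define R where "R = \<bar>t\<bar> + \<bar>\<tau>\<bar> + \<bar>s\<bar> + \<bar>\<eta>\<bar>"
  define \<Phi>s where "\<Phi>s = {F, F11, F12, F21, F22}"
  have "\<forall>\<Phi>\<in>\<Phi>s. \<exists>B. \<forall>t s u w a. \<bar>t\<bar> \<le> R \<longrightarrow> \<bar>s\<bar> \<le> R \<longrightarrow> \<Phi> (gmat t s u w a) \<noteq> 0 \<longrightarrow>
      \<bar>u\<bar> \<le> B \<and> \<bar>w\<bar> \<le> B \<and> \<bar>a\<bar> \<le> B"
  proof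
    fix \<Phi> assume "\<Phi> \<in> \<Phi>s"
    then have "cc_GL2 \<Phi>" using cc by (auto simp: \<Phi>s_def)
    then show "\<exists>B. \<forall>t s u w a. \<bar>t\<bar> \<le> R \<longrightarrow> \<bar>s\<bar> \<le> R \<longrightarrow> \<Phi> (gmat t s u w a) \<noteq> 0 \<longrightarrow>
      \<bar>u\<bar> \<le> B \<and> \<bar>w\<bar> \<le> B \<and> \<bar>a\<bar> \<le> B"
      by (rule gmat_support_bound[of \<Phi> R]) blast
  qed
  from bchoice[OF this] obtain B where B': "\<forall>\<Phi>\<in>\<Phi>s. \<forall>t s u w a. \<bar>t\<bar> \<le> R \<longrightarrow> \<bar>s\<bar> \<le> R \<longrightarrow>
      \<Phi> (gmat t s u w a) \<noteq> 0 \<longrightarrow> \<bar>u\<bar> \<le> B \<Phi> \<and> \<bar>w\<bar> \<le> B \<Phi> \<and> \<bar>a\<bar> \<le> B \<Phi>"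
    by (rule exE)
  have B: "\<bar>u\<bar> \<le> B \<Phi> \<and> \<bar>w\<bar> \<le> B \<Phi> \<and> \<bar>a\<bar> \<le> B \<Phi>"
    if "\<Phi> \<in> \<Phi>s" "\<bar>t\<bar> \<le> R" "\<bar>s\<bar> \<le> R" "\<Phi> (gmat t s u w a) \<noteq> 0" for \<Phi> t s u w a
    using bspec[OF B' that(1)] that(2-) by blast
  define M where "M = Max (B ` \<Phi>s) + \<bar>\<upsilon>\<bar> + \<bar>\<omega>\<bar> + \<bar>\<alpha>\<bar>"
  have BM: "B \<Phi> \<le> Max (B ` \<Phi>s)" if "\<Phi> \<in> \<Phi>s" for \<Phi>
    using that by (auto simp: \<Phi>s_def intro!: Max_ge)
  have zero: "\<Phi> (gmat (t + h * \<tau>) (s + h * \<eta>) (u + h * \<upsilon>) (w + h * \<omega>) (a + h * \<alpha>)) = 0"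
    if h: "\<bar>h\<bar> \<le> 1" and y: "(u, w, a) \<notin> cbox (- M, - M, - M) (M, M, M)" and \<Phi>: "\<Phi> \<in> \<Phi>s" for h u w a \<Phi>
  proof (rule ccontr)
    assume nz: "\<Phi> (gmat (t + h * \<tau>) (s + h * \<eta>) (u + h * \<upsilon>) (w + h * \<omega>) (a + h * \<alpha>)) \<noteq> 0"
    have small: "\<bar>h * x\<bar> \<le> \<bar>x\<bar>" for x
      using mult_right_mono[OF h, of "\<bar>x\<bar>"] by (simp add: abs_mult)
    have "\<bar>t + h * \<tau>\<bar> \<le> R" "\<bar>s + h * \<eta>\<bar> \<le> R"
      using small[of \<tau>] small[of \<eta>] by (auto simp: R_def)
    note b = B[OF \<Phi> this nz]
    have tri: "\<bar>x\<bar> \<le> B \<Phi> + \<bar>\<xi>\<bar>" if "\<bar>x + h * \<xi>\<bar> \<le> B \<Phi>" for x \<xi>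
      using that small[of \<xi>] by linarith
    have "\<bar>u\<bar> \<le> B \<Phi> + \<bar>\<upsilon>\<bar>" "\<bar>w\<bar> \<le> B \<Phi> + \<bar>\<omega>\<bar>" "\<bar>a\<bar> \<le> B \<Phi> + \<bar>\<alpha>\<bar>"
      using b by (auto intro: tri)
    moreover have "B \<Phi> + \<bar>\<upsilon>\<bar> \<le> M" "B \<Phi> + \<bar>\<omega>\<bar> \<le> M" "B \<Phi> + \<bar>\<alpha>\<bar> \<le> M"
      using BM[OF \<Phi>] by (auto simp: M_def)
    ultimately have "\<bar>u\<bar> \<le> M \<and> \<bar>w\<bar> \<le> M \<and> \<bar>a\<bar> \<le> M" by (meson order_trans)
    then show False using y by (auto simp: cbox_Pair_eq abs_le_iff)
  qed
  show thesis
  proof (rule that[of "(- M, - M, - M)" "(M, M, M)"])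
    fix h u w a :: real
    assume "\<bar>h\<bar> \<le> 1" "(u, w, a) \<notin> cbox (- M, - M, - M) (M, M, M)"
    note Z = zero[OF this]
    show "F (gmat (t + h * \<tau>) (s + h * \<eta>) (u + h * \<upsilon>) (w + h * \<omega>) (a + h * \<alpha>)) = 0 \<and>
       dint p \<epsilon> q \<delta> n \<tau> \<eta> \<upsilon> \<omega> \<alpha> (t + h * \<tau>) (s + h * \<eta>) (u + h * \<upsilon>, w + h * \<omega>, a + h * \<alpha>) = 0"
      using Z[of F] Z[of F11] Z[of F12] Z[of F21] Z[of F22] by (simp add: \<Phi>s_def dint_def)
  qed
qed

text \<open>By translation invariance, moving \<open>u\<close>, \<open>w\<close>, \<open>a\<close> along with \<open>t\<close> and \<open>s\<close> does not change the
  integral. So one application of the Leibniz rule contains both differentiation under the integral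
  (move only \<open>t\<close> or \<open>s\<close>) and integration by parts (move only \<open>u\<close>, \<open>w\<close>, \<open>a\<close>, where the left-hand
  side is constant).\<close>

lemma kint_derivative:
  shows "((\<lambda>h. kint F p \<epsilon> q \<delta> n (t + h * \<tau>) (s + h * \<eta>)) has_vector_derivative
           (\<integral>y. dint p \<epsilon> q \<delta> n \<tau> \<eta> \<upsilon> \<omega> \<alpha> t s y \<partial>lborel)) (at 0)"
    and "integrable lborel (dint p \<epsilon> q \<delta> n \<tau> \<eta> \<upsilon> \<omega> \<alpha> t s)"
proof -
  let ?f = "\<lambda>h (u, w, a). F (gmat (t + h * \<tau>) (s + h * \<eta>) (u + h * \<upsilon>) (w + h * \<omega>) (a + h * \<alpha>))
      * wt p \<epsilon> q \<delta> n (u + h * \<upsilon>, w + h * \<omega>, a + h * \<alpha>)"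
  let ?d = "\<lambda>h (u, w, a). dint p \<epsilon> q \<delta> n \<tau> \<eta> \<upsilon> \<omega> \<alpha> (t + h * \<tau>) (s + h * \<eta>)
     (u + h * \<upsilon>, w + h * \<omega>, a + h * \<alpha>)"
  obtain c d :: "real \<times> real \<times> real" where S: "\<And>h u w a. \<bar>h\<bar> \<le> 1 \<Longrightarrow> (u, w, a) \<notin> cbox c d \<Longrightarrow>
       F (gmat (t + h * \<tau>) (s + h * \<eta>) (u + h * \<upsilon>) (w + h * \<omega>) (a + h * \<alpha>)) = 0 \<and>
       dint p \<epsilon> q \<delta> n \<tau> \<eta> \<upsilon> \<omega> \<alpha> (t + h * \<tau>) (s + h * \<eta>) (u + h * \<upsilon>, w + h * \<omega>, a + h * \<alpha>) = 0"
    by (rule path_support[of t \<tau> s \<eta> \<upsilon> \<omega> \<alpha> p \<epsilon> q \<delta> n]) blast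
  have cF: "continuous_on UNIV (\<lambda>(u, w, a). F (gmat t s u w a) * wt p \<epsilon> q \<delta> n (u, w, a))" for t s
    unfolding split_beta
    by (rule continuous_on_weighted[OF cc(1)], (intro continuous_intros)+,
        rule continuous_on_compose2[OF continuous_on_wt]) (auto intro!: continuous_intros)
  have sh: "y + (x1, x2, x3) = (fst y + x1, fst (snd y) + x2, snd (snd y) + x3)"
    for y :: "real \<times> real \<times> real" and x1 x2 x3
    by (cases y) simp
  have tr: "(\<integral>y. ?f h y \<partial>lborel) = kint F p \<epsilon> q \<delta> n (t + h * \<tau>) (s + h * \<eta>)" for h
    using integral_lborel_translate[OF cF[of "t + h * \<tau>" "s + h * \<eta>"], of "(h * \<upsilon>, h * \<omega>, h * \<alpha>)"]
    by (simp add: kint_def split_beta' sh)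
  have cd: "continuous_on UNIV (\<lambda>(h, y). ?d h y)"
    using dint_continuous[of p \<epsilon> q \<delta> n \<tau> \<eta> \<upsilon> \<omega> \<alpha> t s] by (simp add: split_beta')
  have cf: "continuous_on UNIV (?f h)" for h
  proof -
    have "continuous_on UNIV (\<lambda>y. case y + (h * \<upsilon>, h * \<omega>, h * \<alpha>) of (u, w, a) \<Rightarrow>
        F (gmat (t + h * \<tau>) (s + h * \<eta>) u w a) * wt p \<epsilon> q \<delta> n (u, w, a))"
      by (rule continuous_on_compose2[OF cF]) (auto intro!: continuous_intros)
    then show ?thesis by (simp add: split_beta' sh)
  qed
  have S': "?f h y = 0 \<and> ?d h y = 0" if "\<bar>h\<bar> \<le> 1" "y \<notin> cbox c d" for h y
    using S[OF that(1), of "fst y" "fst (snd y)" "snd (snd y)"] that(2) by (simp add: split_beta)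
  have "((\<lambda>h. \<integral>y. ?f h y \<partial>lborel) has_vector_derivative (\<integral>y. ?d 0 y \<partial>lborel)) (at 0)"
  proof (rule has_vector_derivative_integral_compact_support[OF _ cf cd S'])
    show "((\<lambda>h. ?f h y) has_vector_derivative ?d h y) (at h)" for h y
      by (cases y) (simp add: has_vector_derivative_path)
  qed
  then show "((\<lambda>h. kint F p \<epsilon> q \<delta> n (t + h * \<tau>) (s + h * \<eta>)) has_vector_derivative
           (\<integral>y. dint p \<epsilon> q \<delta> n \<tau> \<eta> \<upsilon> \<omega> \<alpha> t s y \<partial>lborel)) (at 0)"
    by (simp add: tr)
  have d0: "?d 0 = dint p \<epsilon> q \<delta> n \<tau> \<eta> \<upsilon> \<omega> \<alpha> t s" by auto
  show "integrable lborel (dint p \<epsilon> q \<delta> n \<tau> \<eta> \<upsilon> \<omega> \<alpha> t s)"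
  proof (rule integral_lborel_compact_support(1))
    have "continuous_on UNIV (\<lambda>y. case (0, y) of (h, y) \<Rightarrow> ?d h y)"
      by (rule continuous_on_compose2[OF cd]) (auto intro!: continuous_intros)
    then show "continuous_on UNIV (dint p \<epsilon> q \<delta> n \<tau> \<eta> \<upsilon> \<omega> \<alpha> t s)" by (simp add: d0)
    show "dint p \<epsilon> q \<delta> n \<tau> \<eta> \<upsilon> \<omega> \<alpha> t s y = 0" if "y \<notin> cbox c d" for y
      using S'[of 0 y] that by (simp add: d0)
  qed
qed

lemma dint_bochner_t:
  "has_bochner_integral lborel (dint p \<epsilon> q \<delta> n 1 0 0 0 0 t s)
     (vector_derivative (\<lambda>t'. kint F p \<epsilon> q \<delta> n t' s) (at t))"
proof -
  have "((\<lambda>h. kint F p \<epsilon> q \<delta> n (t + h) s) has_vector_derivative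
     (\<integral>y. dint p \<epsilon> q \<delta> n 1 0 0 0 0 t s y \<partial>lborel)) (at 0)"
    using kint_derivative(1)[of p \<epsilon> q \<delta> n t 1 s 0 0 0 0] by simp
  then have "((\<lambda>t'. kint F p \<epsilon> q \<delta> n t' s) has_vector_derivative
     (\<integral>y. dint p \<epsilon> q \<delta> n 1 0 0 0 0 t s y \<partial>lborel)) (at t)"
    by (rule has_vector_derivative_at_shift)
  then show ?thesis
    using kint_derivative(2) by (simp add: has_bochner_integral_iff vector_derivative_at)
qed

lemma dint_bochner_s:
  "has_bochner_integral lborel (dint p \<epsilon> q \<delta> n 0 1 0 0 0 t s)
     (vector_derivative (\<lambda>s'. kint F p \<epsilon> q \<delta> n t s') (at s))"
proof -
  have "((\<lambda>h. kint F p \<epsilon> q \<delta> n t (s + h)) has_vector_derivative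
     (\<integral>y. dint p \<epsilon> q \<delta> n 0 1 0 0 0 t s y \<partial>lborel)) (at 0)"
    using kint_derivative(1)[of p \<epsilon> q \<delta> n t 0 s 1 0 0 0] by simp
  then have "((\<lambda>s'. kint F p \<epsilon> q \<delta> n t s') has_vector_derivative
     (\<integral>y. dint p \<epsilon> q \<delta> n 0 1 0 0 0 t s y \<partial>lborel)) (at s)"
    by (rule has_vector_derivative_at_shift)
  then show ?thesis
    using kint_derivative(2) by (simp add: has_bochner_integral_iff vector_derivative_at)
qed

lemma dint_bochner_0:
  "has_bochner_integral lborel (dint p \<epsilon> q \<delta> n 0 0 \<upsilon> \<omega> \<alpha> t s) 0"
proof -
  have "((\<lambda>h. kint F p \<epsilon> q \<delta> n t s) has_vector_derivative
     (\<integral>y. dint p \<epsilon> q \<delta> n 0 0 \<upsilon> \<omega> \<alpha> t s y \<partial>lborel)) (at 0)"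
    using kint_derivative(1)[of p \<epsilon> q \<delta> n t 0 s 0 \<upsilon> \<omega> \<alpha>] by simp
  then have "(\<integral>y. dint p \<epsilon> q \<delta> n 0 0 \<upsilon> \<omega> \<alpha> t s y \<partial>lborel) = 0"
    using has_vector_derivative_const vector_derivative_unique_at by blast
  then show ?thesis
    using kint_derivative(2) by (simp add: has_bochner_integral_iff)
qed
end

section \<open>Existence and explicit form of the kernel\<close>

lemma norm_spow: "x \<noteq> 0 \<Longrightarrow> norm (spow x c \<epsilon>) = \<bar>x\<bar> powr Re c"
  by (simp add: spow_def norm_mult norm_powr_real_powr)

lemma borel_measurable_spow [measurable]: "(\<lambda>x. spow x c \<epsilon>) \<in> borel_measurable borel"
  by (rule borel_measurable_continuous_countable_exceptions[of "{0}"]) (auto intro!: continuous_intros)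

lemma spow_mult: "spow (x * y) c \<epsilon> = spow x c \<epsilon> * spow y c \<epsilon>"
proof (cases "x = 0 \<or> y = 0")
  case False
  then have "complex_of_real \<bar>x * y\<bar> powr c = of_real \<bar>x\<bar> powr c * of_real \<bar>y\<bar> powr c"
    by (simp add: abs_mult powr_times_real)
  then show ?thesis by (simp add: spow_def sgn_mult)
qed auto

lemma spow_add: "spow x c \<epsilon> * spow x d \<delta> = spow x (c + d) (\<epsilon> + \<delta>)"
proof -
  consider "x > 0" | "x < 0" | "x = 0" by linarith
  then show ?thesis
    by cases (cases \<epsilon>; cases \<delta>; simp add: spow_pos spow_neg powr_add)+
qed

text \<open>The exponents of the kernel: the Jacobian $|u|$, the two factors of the principal series and the
  Haar density combine to one power of \<open>u\<close> and one of \<open>w\<close>.\<close>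

lemma principal_series_density:
  assumes "u \<noteq> 0" "w \<noteq> 0"
  shows "of_real \<bar>u\<bar> * (spow u (- 1 + \<mu>1 - \<mu>2) (\<epsilon>1 - \<epsilon>2) * spow (u * w) (1 / 2 + \<mu>2) \<epsilon>2 / of_real ((u * w)\<^sup>2))
     = spow u (\<mu>1 - 3/2) \<epsilon>1 * spow w (\<mu>2 - 3/2) \<epsilon>2"
proof -
  have sq: "1 / of_real (x\<^sup>2) = spow x (- 2) 0" if "x \<noteq> 0" for x
    using that by (simp add: spow_def powr_minus powr_numeral divide_inverse power2_eq_square flip: of_real_power of_real_mult)
  have ab: "of_real \<bar>u\<bar> = spow u 1 0" using assms by (simp add: spow_def)
  have "of_real \<bar>u\<bar> * (spow u (- 1 + \<mu>1 - \<mu>2) (\<epsilon>1 - \<epsilon>2) * spow (u * w) (1 / 2 + \<mu>2) \<epsilon>2 / of_real ((u * w)\<^sup>2))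
    = (spow u 1 0 * spow u (- 1 + \<mu>1 - \<mu>2) (\<epsilon>1 - \<epsilon>2) * spow u (1 / 2 + \<mu>2) \<epsilon>2 * (1 / of_real (u\<^sup>2)))
      * (spow w (1 / 2 + \<mu>2) \<epsilon>2 * (1 / of_real (w\<^sup>2)))"
    by (simp add: ab spow_mult power_mult_distrib)
  also have "\<dots> = spow u (1 + (- 1 + \<mu>1 - \<mu>2) + (1 / 2 + \<mu>2) + - 2) (0 + (\<epsilon>1 - \<epsilon>2) + \<epsilon>2 + 0)
      * spow w (1 / 2 + \<mu>2 + - 2) (\<epsilon>2 + 0)"
    unfolding sq[OF assms(1)] sq[OF assms(2)] spow_add ..
  also have "1 + (- 1 + \<mu>1 - \<mu>2) + (1 / 2 + \<mu>2) + - 2 = \<mu>1 - 3/2" by (simp add: field_simps)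
  also have "1 / 2 + \<mu>2 + - 2 = \<mu>2 - 3/2" by (simp add: field_simps)
  also have "0 + (\<epsilon>1 - \<epsilon>2) + \<epsilon>2 + 0 = \<epsilon>1" by (cases \<epsilon>1; cases \<epsilon>2) auto
  finally show ?thesis by simp
qed

lemma smooth_on_continuous: "smooth_on S f \<Longrightarrow> continuous_on S f"
  unfolding smooth_on_def using Ck_on.simps(1) by blast

text \<open>The second half of the definition of the space bounds $\phi(s)$ by $|s|^{\mathrm{Re}\,\mu-1}$ at
  infinity. In homogeneous coordinates $s = v/u$ the two bounds become a single one, which remains
  finite when \<open>u\<close> tends to \<open>0\<close> with \<open>v\<close> fixed.\<close>

lemma ps_space_bound:
  assumes "\<phi> \<in> ps_space \<mu> \<epsilon>"
  obtains K where "K \<ge> 0" "\<And>u v. u \<noteq> 0 \<Longrightarrow>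
    norm (\<phi> (v / u)) * \<bar>u\<bar> powr (Re \<mu> - 1) \<le> K * max \<bar>u\<bar> \<bar>v\<bar> powr (Re \<mu> - 1)"
proof -
  obtain \<psi> where \<psi>: "smooth_on UNIV \<psi>" "\<And>t. t \<noteq> 0 \<Longrightarrow> \<psi> t = \<phi> (- 1 / t) * spow (- t) (- 1 + \<mu>) \<epsilon>"
    and \<phi>: "smooth_on UNIV \<phi>"
    using assms by (auto simp: ps_space_def)
  have bd: "\<exists>K. \<forall>x. \<bar>x\<bar> \<le> 1 \<longrightarrow> norm (f x) \<le> K" if "smooth_on UNIV f" for f :: "real \<Rightarrow> complex"
  proof -
    have "compact (f ` {-1..1})"
      by (intro compact_continuous_image continuous_on_subset[OF smooth_on_continuous[OF that]]) auto
    from compact_imp_bounded[OF this] obtain K where "\<forall>x\<in>{-1..1}. norm (f x) \<le> K"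
      by (auto simp: bounded_iff)
    then have "\<forall>x. \<bar>x\<bar> \<le> 1 \<longrightarrow> norm (f x) \<le> K" by (simp add: abs_le_iff)
    then show ?thesis ..
  qed
  obtain K1 where K1: "\<And>x. \<bar>x\<bar> \<le> 1 \<Longrightarrow> norm (\<phi> x) \<le> K1" using bd[OF \<phi>] by blast
  obtain K2 where K2: "\<And>x. \<bar>x\<bar> \<le> 1 \<Longrightarrow> norm (\<psi> x) \<le> K2" using bd[OF \<psi>(1)] by blast
  show thesis
  proof (rule that[of "max K1 K2"])
    show "max K1 K2 \<ge> 0" using order_trans[OF norm_ge_zero K1[of 0]] by simp
    fix u v :: real assume u: "u \<noteq> 0"
    let ?e = "Re \<mu> - 1"
    show "norm (\<phi> (v / u)) * \<bar>u\<bar> powr ?e \<le> max K1 K2 * max \<bar>u\<bar> \<bar>v\<bar> powr ?e"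
    proof (cases "\<bar>v\<bar> \<le> \<bar>u\<bar>")
      case True
      then have "\<bar>v / u\<bar> \<le> 1" using u by (simp add: abs_divide)
      then have "norm (\<phi> (v / u)) \<le> max K1 K2" by (rule order_trans[OF K1 max.cobounded1])
      then show ?thesis using True by (simp add: max_def mult_right_mono)
    next
      case False
      then have v: "v \<noteq> 0" by auto
      have "\<bar>- u / v\<bar> \<le> 1" using False v by (simp add: abs_divide)
      then have b: "norm (\<psi> (- u / v)) \<le> max K1 K2" by (rule order_trans[OF K2 max.cobounded2])
      have "\<psi> (- u / v) = \<phi> (v / u) * spow (u / v) (- 1 + \<mu>) \<epsilon>"
        using \<psi>(2)[of "- u / v"] u v by simp
      then have "norm (\<psi> (- u / v)) = norm (\<phi> (v / u)) * (\<bar>u\<bar> powr ?e / \<bar>v\<bar> powr ?e)"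
        using u v by (simp add: norm_mult norm_spow abs_divide powr_divide)
      then have "norm (\<phi> (v / u)) * \<bar>u\<bar> powr ?e = norm (\<psi> (- u / v)) * \<bar>v\<bar> powr ?e"
        using v by simp
      also have "\<dots> \<le> max K1 K2 * \<bar>v\<bar> powr ?e" using b by (intro mult_right_mono) auto
      finally show ?thesis using False by (simp add: max_def)
    qed
  qed
qed

text \<open>The integrand is bounded on the compact support of $\Phi$, because there
  $u = x_{11} + t x_{21}$ and $v = x_{12} + t x_{22}$ do not vanish simultaneously.\<close>

lemma integrable_fourier:
  assumes "cc_GL2 \<Phi>" "\<phi> \<in> ps_space (\<mu>1 - \<mu>2) (\<epsilon>1 - \<epsilon>2)"
  shows "integrable lborel (\<lambda>X. indicator GL2 X *\<^sub>R
     (\<Phi> X * principal_series \<mu>1 \<epsilon>1 \<mu>2 \<epsilon>2 X \<phi> t / of_real ((det X)\<^sup>2)))" (is "integrable _ ?g")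
proof -
  obtain C where C: "compact C" "C \<subseteq> GL2" "\<And>X. X \<notin> C \<Longrightarrow> \<Phi> X = 0" and \<Phi>c: "continuous_on UNIV \<Phi>"
    using assms(1) by (auto simp: cc_GL2_def)
  let ?u = "\<lambda>X::real^2^2. X$1$1 + t * X$2$1" and ?v = "\<lambda>X::real^2^2. X$1$2 + t * X$2$2"
  let ?e = "Re (\<mu>1 - \<mu>2) - 1" and ?r = "Re (1 / 2 + \<mu>2)"
  obtain K where K: "K \<ge> 0" "\<And>u v. u \<noteq> 0 \<Longrightarrow>
    norm (\<phi> (v / u)) * \<bar>u\<bar> powr ?e \<le> K * max \<bar>u\<bar> \<bar>v\<bar> powr ?e"
    by (rule ps_space_bound[OF assms(2)]) blast
  define b where "b X = norm (\<Phi> X) * (K * max \<bar>?u X\<bar> \<bar>?v X\<bar> powr ?e) * (\<bar>det X\<bar> powr ?r / (det X)\<^sup>2)" for X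
  have nz: "max \<bar>?u X\<bar> \<bar>?v X\<bar> \<noteq> 0" "det X \<noteq> 0" if "X \<in> C" for X
  proof -
    show d: "det X \<noteq> 0" using that C(2) by (auto simp: GL2_eq)
    have "det X = ?u X * X$2$2 - ?v X * X$2$1" by (simp add: det_2 algebra_simps)
    with d show "max \<bar>?u X\<bar> \<bar>?v X\<bar> \<noteq> 0" by (auto simp: max_def split: if_splits)
  qed
  have "continuous_on C b"
    unfolding b_def
    by (intro continuous_intros continuous_on_det2 continuous_on_subset[OF \<Phi>c]) (use nz in auto)
  then have "compact (b ` C)" using C(1) by (intro compact_continuous_image)
  then obtain M where M: "\<And>X. X \<in> C \<Longrightarrow> \<bar>b X\<bar> \<le> M"
    using compact_imp_bounded[of "b ` C"] by (auto simp: bounded_iff)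
  have gb: "norm (?g X) \<le> b X" for X
  proof (cases "?u X = 0 \<or> X \<notin> GL2")
    case True
    then have "?g X = 0" by (auto simp: principal_series_def)
    then have "norm (?g X) = 0" by (simp only: norm_zero)
    moreover have "b X \<ge> 0" using K(1) by (auto simp: b_def intro!: mult_nonneg_nonneg)
    ultimately show ?thesis by (simp only:)
  next
    case False
    then have u: "?u X \<noteq> 0" and X: "X \<in> GL2" "det X \<noteq> 0" by (auto simp: GL2_eq)
    have "norm (?g X) = norm (\<Phi> X) * (norm (\<phi> (?v X / ?u X)) * \<bar>?u X\<bar> powr ?e) * (\<bar>det X\<bar> powr ?r / (det X)\<^sup>2)"
      using u X by (simp add: principal_series_def norm_mult norm_divide norm_spow norm_power
          cancel_ab_semigroup_add_class.diff_right_commute[of "Re \<mu>1" 1])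
    also have "\<dots> \<le> b X"
      unfolding b_def by (intro mult_left_mono mult_right_mono K(2)[OF u]) auto
    finally show ?thesis .
  qed
  have [measurable]: "\<Phi> \<in> borel_measurable borel" "\<phi> \<in> borel_measurable borel"
    using \<Phi>c assms(2) by (auto intro!: borel_measurable_continuous_onI smooth_on_continuous simp: ps_space_def)
  have [measurable]: "GL2 \<in> sets borel" "(det :: real^2^2 \<Rightarrow> real) \<in> borel_measurable borel"
    "?u \<in> borel_measurable borel" "?v \<in> borel_measurable borel"
    using open_GL2 by (auto intro!: borel_measurable_continuous_onI continuous_on_det2 continuous_intros)
  show ?thesis
  proof (rule integrableI_bounded_set[of C _ _ M])
    show "C \<in> sets lborel" using C(1) by (simp add: borel_compact)
    show "emeasure lborel C < \<infinity>" by (rule emeasure_compact_finite[OF C(1)])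
    show "?g \<in> borel_measurable lborel"
      unfolding principal_series_def by measurable
    show "AE x\<in>C in lborel. norm (?g x) \<le> M"
      using gb M by (intro AE_I2 impI) (meson abs_ge_self order_trans)
    show "AE x in lborel. x \<notin> C \<longrightarrow> ?g x = 0"
      using C(3) by (intro AE_I2) auto
  qed
qed

lemma is_kernel_kint:
  assumes "cc_GL2 \<Phi>"
  shows "is_kernel \<Phi> \<mu>1 \<epsilon>1 \<mu>2 \<epsilon>2 (kint \<Phi> (\<mu>1 - 3/2) \<epsilon>1 (\<mu>2 - 3/2) \<epsilon>2 0)"
  unfolding is_kernel_def
proof (intro conjI ballI allI)
  let ?w = "wt (\<mu>1 - 3/2) \<epsilon>1 (\<mu>2 - 3/2) \<epsilon>2 0"
  show "continuous_on UNIV (\<lambda>(t, s). kint \<Phi> (\<mu>1 - 3/2) \<epsilon>1 (\<mu>2 - 3/2) \<epsilon>2 0 t s)"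
    unfolding kint_def by (rule continuous_on_integral_gmat[OF assms continuous_on_wt])
  fix \<phi> t assume \<phi>: "\<phi> \<in> ps_space (\<mu>1 - \<mu>2) (\<epsilon>1 - \<epsilon>2)"
  let ?g = "\<lambda>X. indicator GL2 X *\<^sub>R
     (\<Phi> X * principal_series \<mu>1 \<epsilon>1 \<mu>2 \<epsilon>2 X \<phi> t / of_real ((det X)\<^sup>2))"
  define m where "m = (\<lambda>(s, u, w, a). gmat t s u w a)"
  let ?d = "\<lambda>y::real \<times> real \<times> real \<times> real. \<bar>fst (snd y)\<bar>"
  define f where "f = (\<lambda>(s, u, w, a). (\<Phi> (gmat t s u w a) * ?w (u, w, a)) * \<phi> s)"
  note I = integrable_fourier[OF assms \<phi>, of t]
  have mm: "m \<in> borel_measurable borel"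
    unfolding m_def split_beta by (intro borel_measurable_continuous_onI continuous_intros)
  have dm: "?d \<in> borel_measurable borel"
    by (intro borel_measurable_continuous_onI continuous_intros)
  have gm: "?g \<in> borel_measurable borel" using borel_measurable_integrable[OF I] by simp
  have L: "(lborel :: (real^2^2) measure) = distr (density lborel (\<lambda>y. ennreal (?d y))) borel m"
    using lborel_eq_distr_gmat[of t] by (simp add: m_def split_beta')
  have m1: "m \<in> measurable (density lborel (\<lambda>y. ennreal (?d y))) borel" using mm by simp
  have gmm: "(\<lambda>y. ?g (m y)) \<in> borel_measurable lborel"
    using measurable_compose[OF mm gm] by simp
  have eq: "?d y *\<^sub>R ?g (m y) = f y" for y
  proof (cases y)
    case (fields s u w a)
    show ?thesis
    proof (cases "u * w = 0")
      case True
      then show ?thesis using cc_GL2_singular[OF assms True] by (simp add: fields m_def f_def)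
    next
      case False
      have X: "gmat t s u w a \<in> GL2" using False by (simp add: GL2_eq det_gmat)
      have c: "(gmat t s u w a)$1$1 + t * (gmat t s u w a)$2$1 = u"
         "(gmat t s u w a)$1$2 + t * (gmat t s u w a)$2$2 = u * s"
        by (auto simp: gmat_def algebra_simps)
      have "?d y *\<^sub>R ?g (m y) = \<Phi> (gmat t s u w a) * \<phi> s *
         (of_real \<bar>u\<bar> * (spow u (- 1 + \<mu>1 - \<mu>2) (\<epsilon>1 - \<epsilon>2) * spow (u * w) (1 / 2 + \<mu>2) \<epsilon>2 / of_real ((u * w)\<^sup>2)))"
        using X False by (simp add: fields m_def principal_series_def c det_gmat scaleR_conv_of_real)
      also have "\<dots> = f y"
        using False by (subst principal_series_density) (auto simp: f_def fields wt_def)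
      finally show ?thesis .
    qed
  qed
  have "integrable (distr (density lborel (\<lambda>y. ennreal (?d y))) borel m) ?g"
    using I L by simp
  then have "integrable (density lborel (\<lambda>y. ennreal (?d y))) (\<lambda>y. ?g (m y))"
    by (subst (asm) integrable_distr_eq[OF m1 gm])
  then have If: "integrable lborel f"
    by (subst (asm) integrable_density[OF gmm]) (use dm eq in auto)
  have "fourier \<Phi> \<mu>1 \<epsilon>1 \<mu>2 \<epsilon>2 \<phi> t = (\<integral>X. ?g X \<partial>lborel)"
    by (simp add: fourier_def set_lebesgue_integral_def)
  also have "\<dots> = (\<integral>X. ?g X \<partial>distr (density lborel (\<lambda>y. ennreal (?d y))) borel m)"
    using L by simp
  also have "\<dots> = (\<integral>y. ?g (m y) \<partial>density lborel (\<lambda>y. ennreal (?d y)))"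
    by (rule integral_distr[OF m1 gm])
  also have "\<dots> = (\<integral>y. f y \<partial>lborel)"
    by (subst integral_density[OF gmm]) (use dm eq in auto)
  finally have F: "fourier \<Phi> \<mu>1 \<epsilon>1 \<mu>2 \<epsilon>2 \<phi> t = (\<integral>y. f y \<partial>lborel)" .
  have If': "integrable (lborel \<Otimes>\<^sub>M lborel) f" using If by (simp add: lborel_prod)
  have inner: "(\<integral>y. f (s, y) \<partial>lborel) = kint \<Phi> (\<mu>1 - 3/2) \<epsilon>1 (\<mu>2 - 3/2) \<epsilon>2 0 t s * \<phi> s" for s
    unfolding kint_def f_def by (simp add: split_beta')
  have "integrable lborel (\<lambda>s. \<integral>y. f (s, y) \<partial>lborel)"
    "(\<integral>s. \<integral>y. f (s, y) \<partial>lborel \<partial>lborel) = (\<integral>y. f y \<partial>lborel)"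
    using lborel_pair.integrable_fst'[OF If'] lborel_pair.integral_fst'[OF If'] by (auto simp: lborel_prod)
  then show "has_bochner_integral lborel (\<lambda>s. kint \<Phi> (\<mu>1 - 3/2) \<epsilon>1 (\<mu>2 - 3/2) \<epsilon>2 0 t s * \<phi> s)
     (fourier \<Phi> \<mu>1 \<epsilon>1 \<mu>2 \<epsilon>2 \<phi> t)"
    unfolding has_bochner_integral_iff inner F by simp
qed

lemma fourier_kernel_eq_kint:
  assumes "cc_GL2 \<Phi>"
  shows "fourier_kernel \<Phi> t s \<mu>1 \<epsilon>1 \<mu>2 \<epsilon>2 = kint \<Phi> (\<mu>1 - 3/2) \<epsilon>1 (\<mu>2 - 3/2) \<epsilon>2 0 t s"
proof -
  have "(THE k. is_kernel \<Phi> \<mu>1 \<epsilon>1 \<mu>2 \<epsilon>2 k) = kint \<Phi> (\<mu>1 - 3/2) \<epsilon>1 (\<mu>2 - 3/2) \<epsilon>2 0"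
    using is_kernel_kint[OF assms] is_kernel_unique by (intro the_equality) auto
  then show ?thesis by (simp add: fourier_kernel_def)
qed

section \<open>Weighted integrals\<close>

lemma spow_int:
  assumes "x \<noteq> 0"
  shows "spow x (p + of_int i) (\<epsilon> + of_int i) = spow x p \<epsilon> * of_real x powi i"
proof (induction i rule: int_induct[where k=0])
  case base
  show ?case by simp
next
  case (step1 i)
  have "spow x (p + of_int (i + 1)) (\<epsilon> + of_int (i + 1)) = of_real x * spow x (p + of_int i) (\<epsilon> + of_int i)"
    using spow_Suc[of x "p + of_int i" "\<epsilon> + of_int i"] by (simp add: add.assoc)
  then show ?case using step1 assms by (simp add: power_int_add)
next
  case (step2 i)
  have b: "\<epsilon> + of_int (i - 1) = (\<epsilon> + of_int i) + 1"
    by (simp add: add.assoc)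
  have "spow x (p + of_int (i - 1)) (\<epsilon> + of_int (i - 1)) = spow x (p + of_int i) (\<epsilon> + of_int i) / of_real x"
    unfolding b using spow_pred[of x "p + of_int i" "\<epsilon> + of_int i"] by (simp add: add_diff_eq)
  then show ?case using step2 assms by (simp add: power_int_diff)
qed

text \<open>A separate constant, so that simplification keeps the parity attached to the exponent it belongs
  to instead of evaluating the sum in \<^typ>\<open>bit\<close>.\<close>

definition bshift :: "bit \<Rightarrow> int \<Rightarrow> bit" where
  "bshift \<epsilon> i = \<epsilon> + of_int i"

text \<open>The integral of \<open>e\<close> against the weight of the unshifted kernel. The weight vanishes for
  $uw = 0$, so only values of \<open>e\<close> at nonzero \<open>u\<close> and \<open>w\<close> matter (\<open>has_wint_cong\<close>).\<close>

definition has_wint :: "complex \<Rightarrow> bit \<Rightarrow> complex \<Rightarrow> bit \<Rightarrow> (real \<Rightarrow> real \<Rightarrow> real \<Rightarrow> complex) \<Rightarrow> complex \<Rightarrow> bool" where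
  "has_wint p \<epsilon> q \<delta> e v \<longleftrightarrow>
     has_bochner_integral lborel (\<lambda>(u, w, a). e u w a * (spow u p \<epsilon> * spow w q \<delta>)) v"

lemma has_wintI:
  assumes "has_bochner_integral lborel f v"
    "\<And>u w a. u \<noteq> 0 \<Longrightarrow> w \<noteq> 0 \<Longrightarrow> f (u, w, a) = e u w a * (spow u p \<epsilon> * spow w q \<delta>)"
    "\<And>u w a. u = 0 \<or> w = 0 \<Longrightarrow> f (u, w, a) = 0"
  shows "has_wint p \<epsilon> q \<delta> e v"
proof -
  have "f = (\<lambda>(u, w, a). e u w a * (spow u p \<epsilon> * spow w q \<delta>))"
  proof (rule ext)
    fix y :: "real \<times> real \<times> real"
    show "f y = (case y of (u, w, a) \<Rightarrow> e u w a * (spow u p \<epsilon> * spow w q \<delta>))"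
      using assms(2)[of "fst y" "fst (snd y)" "snd (snd y)"] assms(3)[of "fst y" "fst (snd y)" "snd (snd y)"]
      by (cases y) fastforce
  qed
  then show ?thesis using assms(1) by (simp add: has_wint_def)
qed

lemma has_wint_cong:
  assumes "has_wint p \<epsilon> q \<delta> e v" "\<And>u w a. u \<noteq> 0 \<Longrightarrow> w \<noteq> 0 \<Longrightarrow> e u w a = e' u w a"
  shows "has_wint p \<epsilon> q \<delta> e' v"
  using assms(1)[unfolded has_wint_def] by (rule has_wintI) (use assms(2) in auto)

lemma has_wint_add:
  assumes "has_wint p \<epsilon> q \<delta> e v" "has_wint p \<epsilon> q \<delta> e' v'"
  shows "has_wint p \<epsilon> q \<delta> (\<lambda>u w a. e u w a + e' u w a) (v + v')"
  using has_bochner_integral_add[OF assms[unfolded has_wint_def]]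
  by (simp add: has_wint_def split_beta' distrib_right)

lemma has_wint_cmult:
  assumes "has_wint p \<epsilon> q \<delta> e v"
  shows "has_wint p \<epsilon> q \<delta> (\<lambda>u w a. c * e u w a) (c * v)"
  using has_bochner_integral_mult_right[OF assms[unfolded has_wint_def], of c]
  by (simp add: has_wint_def split_beta' mult.assoc)

lemma has_wint_kint:
  assumes "has_wint p \<epsilon> q \<delta> e v" "\<And>u w a. u \<noteq> 0 \<Longrightarrow> w \<noteq> 0 \<Longrightarrow> \<Phi> (gmat t s u w a) = e u w a"
  shows "kint \<Phi> p \<epsilon> q \<delta> 0 t s = v"
proof -
  have "has_wint p \<epsilon> q \<delta> (\<lambda>u w a. \<Phi> (gmat t s u w a)) v"
    by (rule has_wint_cong[OF assms(1)]) (simp add: assms(2))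
  then show ?thesis
    unfolding has_wint_def kint_def wt_def
    by (simp add: has_bochner_integral_integral_eq split_beta')
qed

lemma wt_int:
  assumes "u \<noteq> 0" "w \<noteq> 0"
  shows "wt (p + of_int i) (bshift \<epsilon> i) (q + of_int j) (bshift \<delta> j) n (u, w, a)
    = (of_real u powi i * of_real w powi j * of_real a ^ n) * (spow u p \<epsilon> * spow w q \<delta>)"
  unfolding wt_def bshift_def prod.case spow_int[OF assms(1)] spow_int[OF assms(2)] by simp

lemma (in C1_GL2) dint_singular:
  assumes "u = 0 \<or> w = 0"
  shows "dint p \<epsilon> q \<delta> n \<tau> \<eta> \<upsilon> \<omega> \<alpha> t s (u, w, a) = 0"
proof -
  have "u * w = 0" using assms by auto
  note cc[THEN cc_GL2_singular, OF this]
  then show ?thesis by (simp add: dint_def)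
qed

text \<open>The exponents \<open>p\<close> and \<open>q\<close> stand for $\mu_1 - 3/2$ and $\mu_2 - 3/2$.\<close>

locale C1_GL2_at = C1_GL2 +
  fixes p q :: complex and \<epsilon> \<delta> :: bit and t s :: real
begin

abbreviation f where "f u w a \<equiv> F (gmat t s u w a)"
abbreviation f11 where "f11 u w a \<equiv> F11 (gmat t s u w a)"
abbreviation f12 where "f12 u w a \<equiv> F12 (gmat t s u w a)"
abbreviation f21 where "f21 u w a \<equiv> F21 (gmat t s u w a)"
abbreviation f22 where "f22 u w a \<equiv> F22 (gmat t s u w a)"

definition shifted_kernel :: "int \<Rightarrow> int \<Rightarrow> real \<Rightarrow> real \<Rightarrow> complex" where
  "shifted_kernel i j t' s' = kint F (p + of_int i) (bshift \<epsilon> i) (q + of_int j) (bshift \<delta> j) 0 t' s'"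

lemma wint_K: "has_wint p \<epsilon> q \<delta> (\<lambda>u w a. f u w a * (of_real u powi i * of_real w powi j)) (shifted_kernel i j t s)"
proof (rule has_wintI)
  let ?w = "wt (p + of_int i) (bshift \<epsilon> i) (q + of_int j) (bshift \<delta> j) 0"
  show "has_bochner_integral lborel (\<lambda>(u, w, a). f u w a * ?w (u, w, a)) (shifted_kernel i j t s)"
    unfolding shifted_kernel_def kint_def using integrable_gmat[OF cc(1) continuous_on_wt] by (simp add: has_bochner_integral_iff)
qed (use cc_GL2_singular[OF cc(1)] in \<open>auto simp: wt_int\<close>)

lemma wint_T: "has_wint p \<epsilon> q \<delta>
    (\<lambda>u w a. - (of_real a * f11 u w a + (of_real w + of_real s * of_real a) * f12 u w a) * (of_real u powi i * of_real w powi j))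
    (vector_derivative (\<lambda>t'. shifted_kernel i j t' s) (at t))"
  unfolding shifted_kernel_def
  by (rule has_wintI[OF dint_bochner_t])
     (simp add: dint_def dwt_def wt_int algebra_simps, rule dint_singular)

lemma wint_S: "has_wint p \<epsilon> q \<delta>
    (\<lambda>u w a. ((of_real u - of_real t * of_real a) * f12 u w a + of_real a * f22 u w a) * (of_real u powi i * of_real w powi j))
    (vector_derivative (\<lambda>s'. shifted_kernel i j t s') (at s))"
  unfolding shifted_kernel_def
  by (rule has_wintI[OF dint_bochner_s])
     (simp add: dint_def dwt_def wt_int algebra_simps, rule dint_singular)

text \<open>The next three lemmas integrate by parts in \<open>u\<close>, \<open>w\<close> and \<open>a\<close>. The first factor in each is the
  derivative of $F(X)$ in that variable together with the logarithmic derivative of the weight.\<close>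

lemma wint_U: "has_wint p \<epsilon> q \<delta>
    (\<lambda>u w a. (f11 u w a + of_real s * f12 u w a + (p + of_int i) * f u w a / of_real u)
       * (of_real u powi i * of_real w powi j * of_real a ^ n)) 0"
  by (rule has_wintI[OF dint_bochner_0[of "p + of_int i" "bshift \<epsilon> i" "q + of_int j" "bshift \<delta> j" n 1 0 0 t s]])
     (simp add: dint_def dwt_def wt_int algebra_simps, rule dint_singular)

lemma wint_W: "has_wint p \<epsilon> q \<delta>
    (\<lambda>u w a. (f22 u w a - of_real t * f12 u w a + (q + of_int j) * f u w a / of_real w)
       * (of_real u powi i * of_real w powi j * of_real a ^ n)) 0"
  by (rule has_wintI[OF dint_bochner_0[of "p + of_int i" "bshift \<epsilon> i" "q + of_int j" "bshift \<delta> j" n 0 1 0 t s]])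
     (simp add: dint_def dwt_def wt_int algebra_simps, rule dint_singular)

lemma wint_A: "has_wint p \<epsilon> q \<delta>
    (\<lambda>u w a. (f21 u w a + of_real s * f22 u w a - of_real t * (f11 u w a + of_real s * f12 u w a))
       * (of_real u powi i * of_real w powi j * of_real a ^ n)
       + of_nat n * f u w a * (of_real u powi i * of_real w powi j * of_real a ^ (n - 1))) 0"
  by (rule has_wintI[OF dint_bochner_0[of "p + of_int i" "bshift \<epsilon> i" "q + of_int j" "bshift \<delta> j" n 0 0 1 t s]])
     (simp add: dint_def dwt_def wt_int algebra_simps, rule dint_singular)


text \<open>Here the linear relation between the five derivatives enters: the combination below of derivatives
  in \<open>t\<close>, \<open>s\<close>, \<open>u\<close>, \<open>w\<close> cancels except for the derivatives of the weight, which contribute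
  $p - q = \mu_1 - \mu_2$ times $a\,F(X)$.\<close>

lemma wint_a_plus:
  assumes "p \<noteq> q"
  shows "has_wint p \<epsilon> q \<delta> (\<lambda>u w a. f u w a * of_real a)
    ((1 / (p - q)) * (vector_derivative (\<lambda>t'. shifted_kernel 1 0 t' s) (at t) + vector_derivative (\<lambda>s'. shifted_kernel 0 1 t s') (at s)))"
proof -
  have "has_wint p \<epsilon> q \<delta> (\<lambda>u w a. f u w a * of_real a)
    ((1 / (p - q)) * ((vector_derivative (\<lambda>t'. shifted_kernel 1 0 t' s) (at t) + vector_derivative (\<lambda>s'. shifted_kernel 0 1 t s') (at s)) + (0 + - 1 * 0)))"
    by (rule has_wint_cong[OF has_wint_cmult[OF has_wint_add[OF has_wint_add[OF wint_T wint_S]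
            has_wint_add[OF wint_U[of 1 0 1] has_wint_cmult[OF wint_W[where i=0 and j=1 and n=1], of "- 1"]]]]])
       (use assms in \<open>simp add: field_simps\<close>)
  then show ?thesis by simp
qed

text \<open>The same relation divided by $uw$.\<close>

lemma wint_a_minus:
  assumes "p \<noteq> q"
  shows "has_wint p \<epsilon> q \<delta> (\<lambda>u w a. f u w a * (of_real a / (of_real u * of_real w)))
    ((1 / (p - q)) * (vector_derivative (\<lambda>t'. shifted_kernel 0 (- 1) t' s) (at t) + vector_derivative (\<lambda>s'. shifted_kernel (- 1) 0 t s') (at s)))"
proof -
  have "has_wint p \<epsilon> q \<delta> (\<lambda>u w a. f u w a * (of_real a / (of_real u * of_real w)))
    ((1 / (p - q)) * ((vector_derivative (\<lambda>t'. shifted_kernel 0 (- 1) t' s) (at t) + vector_derivative (\<lambda>s'. shifted_kernel (- 1) 0 t s') (at s)) + (0 + - 1 * 0)))"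
    by (rule has_wint_cong[OF has_wint_cmult[OF has_wint_add[OF has_wint_add[OF wint_T wint_S]
            has_wint_add[OF wint_U[of 0 "- 1" 1] has_wint_cmult[OF wint_W[where i="- 1" and j=0 and n=1], of "- 1"]]]]])
       (use assms in \<open>simp add: field_simps power_int_minus\<close>)
  then show ?thesis by simp
qed

end

section \<open>The sixteen operators\<close>

lemma has_wint_eqI:
  assumes "has_wint p \<epsilon> q \<delta> e v" "\<And>u w a. u \<noteq> 0 \<Longrightarrow> w \<noteq> 0 \<Longrightarrow> e u w a = e' u w a" "v = v'"
  shows "has_wint p \<epsilon> q \<delta> e' v'"
  using has_wint_cong[OF assms(1,2)] assms(3) by simp

lemma gmat_nth:
  "gmat t s u w a $ 1 $ 1 = u - t * a" "gmat t s u w a $ 1 $ 2 = u * s - t * (w + s * a)"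
  "gmat t s u w a $ 2 $ 1 = a" "gmat t s u w a $ 2 $ 2 = w + s * a"
  by (simp_all add: gmat_def)

lemma bshift_simps: "bshift \<epsilon> 0 = \<epsilon>" "bshift \<epsilon> 1 = \<epsilon> + 1" "bshift \<epsilon> (- 1) = \<epsilon> + 1"
  by (simp_all add: bshift_def)

lemma cc_GL2_uminus: "cc_GL2 \<Phi> \<Longrightarrow> cc_GL2 (\<lambda>X. - \<Phi> X)"
  using cc_GL2_mult[of \<Phi> "\<lambda>_. - 1"] by simp

lemma cc_GL2_diff: "cc_GL2 \<Phi> \<Longrightarrow> cc_GL2 \<Psi> \<Longrightarrow> cc_GL2 (\<lambda>X. \<Phi> X - \<Psi> X)"
  using cc_GL2_add[OF _ cc_GL2_uminus, of \<Phi> \<Psi>] by simp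

context C1_GL2
begin

lemma partial_eq: "partial i j F X = (if i = 1 then if j = 1 then F11 X else F12 X else if j = 1 then F21 X else F22 X)"
proof -
  let ?V = "axis i (axis j 1) :: real^2^2"
  have "((\<lambda>h. X + h *\<^sub>R ?V) has_vector_derivative ?V) (at 0)"
    by (auto intro!: derivative_eq_intros)
  from vector_derivative_diff_chain_within[OF this has_derivative_at_withinI[OF deriv], unfolded o_def]
  have "((\<lambda>h. F (X + h *\<^sub>R ?V)) has_vector_derivative of_real (?V$1$1) * F11 X + of_real (?V$1$2) * F12 X
       + of_real (?V$2$1) * F21 X + of_real (?V$2$2) * F22 X) (at 0)"
    by simp
  moreover have "of_real (?V$1$1) * F11 X + of_real (?V$1$2) * F12 X + of_real (?V$2$1) * F21 X + of_real (?V$2$2) * F22 X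
    = (if i = 1 then if j = 1 then F11 X else F12 X else if j = 1 then F21 X else F22 X)"
    using exhaust_2[of i] exhaust_2[of j] by (auto simp: axis_def)
  ultimately show ?thesis
    by (simp add: partial_def vector_derivative_at)
qed

lemma cc_GL2_e_op:
  assumes "k \<in> {1..4}" "l \<in> {1..4}"
  shows "cc_GL2 (e_op \<sigma> k l F)"
proof -
  have x: "continuous_on GL2 (\<lambda>X::real^2^2. complex_of_real (X$i$j))" for i j
    by (intro continuous_intros)
  have d: "continuous_on GL2 (\<lambda>X::real^2^2. complex_of_real (det X))"
    by (intro continuous_on_of_real continuous_on_det2)
  have nz: "\<forall>X\<in>GL2. complex_of_real (det X) \<noteq> 0" by (simp add: GL2_eq)
  note c = continuous_on_mult continuous_on_power continuous_on_minus continuous_on_const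
    continuous_on_divide[OF _ d nz] x
  have "k = 1 \<or> k = 2 \<or> k = 3 \<or> k = 4" "l = 1 \<or> l = 2 \<or> l = 3 \<or> l = 4"
    using assms by auto
  then show ?thesis
    unfolding e_op_def[abs_def] Let_def partial_eq
    by (elim disjE, simp_all del: times_divide_eq_left times_divide_eq_right mult_minus_left mult_minus_right)
       (intro cc_GL2_add cc_GL2_diff cc_GL2_uminus cc_GL2_mult cc c)+
qed

end

context C1_GL2_at
begin

lemma fourier_kernel_shifted:
  "fourier_kernel F t' s' (p + 3/2) \<epsilon> (q + 3/2) \<delta> = shifted_kernel 0 0 t' s'"
  "V1m (fourier_kernel F) t' s' (p + 3/2) \<epsilon> (q + 3/2) \<delta> = shifted_kernel (- 1) 0 t' s'"
  "V1p (fourier_kernel F) t' s' (p + 3/2) \<epsilon> (q + 3/2) \<delta> = shifted_kernel 1 0 t' s'"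
  "V2m (fourier_kernel F) t' s' (p + 3/2) \<epsilon> (q + 3/2) \<delta> = shifted_kernel 0 (- 1) t' s'"
  "V2p (fourier_kernel F) t' s' (p + 3/2) \<epsilon> (q + 3/2) \<delta> = shifted_kernel 0 1 t' s'"
proof -
  have "x + 3/2 - 1 - 3/2 = x + of_int (- 1)" "x + 3/2 + 1 - 3/2 = x + of_int 1" "x + 3/2 - 3/2 = x + of_int 0"
    for x :: complex
    by (simp_all add: field_simps)
  note shift = this
  show "fourier_kernel F t' s' (p + 3/2) \<epsilon> (q + 3/2) \<delta> = shifted_kernel 0 0 t' s'"
    "V1m (fourier_kernel F) t' s' (p + 3/2) \<epsilon> (q + 3/2) \<delta> = shifted_kernel (- 1) 0 t' s'"
    "V1p (fourier_kernel F) t' s' (p + 3/2) \<epsilon> (q + 3/2) \<delta> = shifted_kernel 1 0 t' s'"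
    "V2m (fourier_kernel F) t' s' (p + 3/2) \<epsilon> (q + 3/2) \<delta> = shifted_kernel 0 (- 1) t' s'"
    "V2p (fourier_kernel F) t' s' (p + 3/2) \<epsilon> (q + 3/2) \<delta> = shifted_kernel 0 1 t' s'"
    by (simp_all only: V1m_def V1p_def V2m_def V2p_def fourier_kernel_eq_kint[OF cc(1)] shifted_kernel_def bshift_simps shift)
qed

lemma shift_diff: "p + 3/2 - (q + 3/2) = p - q"
  by simp

text \<open>The sixteen formulas. In each proof the first argument of the rule lists the integrals whose
  combination is $e_{kl}F$: those named \<open>U\<close>, \<open>W\<close>, \<open>A\<close> vanish as total derivatives, \<open>T\<close>, \<open>S\<close>, \<open>K\<close>
  are $\partial_t$, $\partial_s$ and the value of a shifted kernel. The combinations come from writing the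
  derivatives of \<open>F\<close> in terms of those of $G$, for example
  $\partial_{12}F = (\partial_s G - a\,\partial_w G)/u$ and $\partial_{11}F = \partial_u G - s\,\partial_{12}F$. Two
  identities are checked in each case: that the combination is $e_{kl}F$ pointwise, and that the values
  add up to $E_{kl}K$; writing $p = q + m$ makes the denominator in the latter a variable.\<close>

lemmas e_simps = e_op_def Let_def partial_eq gmat_nth det_gmat power_int_minus power2_eq_square
lemmas E_simps = E_op_def Let_def Dt_def Ds_def fourier_kernel_shifted shift_diff power2_eq_square

lemma wint_e11:
  assumes pq: "p \<noteq> q"
  shows "has_wint p \<epsilon> q \<delta> (\<lambda>u w a. e_op \<sigma> 1 1 F (gmat t s u w a))
     (E_op \<sigma> 1 1 (fourier_kernel F) t s (p + 3/2) \<epsilon> (q + 3/2) \<delta>)"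
proof -
  obtain m where m: "p = q + m" "m \<noteq> 0" using pq that[of "p - q"] by simp
  show ?thesis
    apply (rule has_wint_eqI[OF has_wint_add[OF has_wint_cmult[OF wint_U[where i=1 and j=0 and n=0], of "- 1"]
      has_wint_add[OF has_wint_cmult[OF wint_T[where i=0 and j=0], of "- of_real t"]
      has_wint_cmult[OF wint_K[where i=0 and j=0], of "p + 1"]]]])
     apply (use pq in \<open>simp add: e_simps field_simps\<close>)[1]
    apply (simp add: E_simps; use m(2) in \<open>simp add: m(1) field_simps\<close>)
    done
qed

lemma wint_e12:
  assumes pq: "p \<noteq> q"
  shows "has_wint p \<epsilon> q \<delta> (\<lambda>u w a. e_op \<sigma> 1 2 F (gmat t s u w a))
     (E_op \<sigma> 1 2 (fourier_kernel F) t s (p + 3/2) \<epsilon> (q + 3/2) \<delta>)"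
proof -
  obtain m where m: "p = q + m" "m \<noteq> 0" using pq that[of "p - q"] by simp
  show ?thesis
    apply (rule has_wint_eqI[OF has_wint_cmult[OF wint_T[where i=0 and j=0], of "1"]])
     apply (use pq in \<open>simp add: e_simps field_simps\<close>)[1]
    apply (simp add: E_simps; use m(2) in \<open>simp add: m(1) field_simps\<close>)
    done
qed

lemma wint_e13:
  assumes pq: "p \<noteq> q"
  shows "has_wint p \<epsilon> q \<delta> (\<lambda>u w a. e_op \<sigma> 1 3 F (gmat t s u w a))
     (E_op \<sigma> 1 3 (fourier_kernel F) t s (p + 3/2) \<epsilon> (q + 3/2) \<delta>)"
proof -
  obtain m where m: "p = q + m" "m \<noteq> 0" using pq that[of "p - q"] by simp
  show ?thesis
    apply (rule has_wint_eqI[OF has_wint_add[OF has_wint_cmult[OF wint_U[where i=0 and j=0 and n=0], of "1"]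
      has_wint_add[OF has_wint_cmult[OF wint_W[where i="- 1" and j=0 and n=1], of "of_real s"]
      has_wint_add[OF has_wint_cmult[OF wint_K[where i="- 1" and j=0], of "\<sigma> - 1 - p"]
      has_wint_add[OF has_wint_cmult[OF wint_S[where i="- 1" and j=0], of "- of_real s"]
      has_wint_cmult[OF wint_a_minus[OF pq], of "of_real s * (\<sigma> - 1 - q)"]]]]]])
     apply (use pq in \<open>simp add: e_simps field_simps\<close>)[1]
    apply (simp add: E_simps; use m(2) in \<open>simp add: m(1) field_simps\<close>)
    done
qed

lemma wint_e14:
  assumes pq: "p \<noteq> q"
  shows "has_wint p \<epsilon> q \<delta> (\<lambda>u w a. e_op \<sigma> 1 4 F (gmat t s u w a))
     (E_op \<sigma> 1 4 (fourier_kernel F) t s (p + 3/2) \<epsilon> (q + 3/2) \<delta>)"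
proof -
  obtain m where m: "p = q + m" "m \<noteq> 0" using pq that[of "p - q"] by simp
  show ?thesis
    apply (rule has_wint_eqI[OF has_wint_add[OF has_wint_cmult[OF wint_S[where i="- 1" and j=0], of "1"]
      has_wint_add[OF has_wint_cmult[OF wint_W[where i="- 1" and j=0 and n=1], of "- 1"]
      has_wint_cmult[OF wint_a_minus[OF pq], of "q - \<sigma> + 1"]]]])
     apply (use pq in \<open>simp add: e_simps field_simps\<close>)[1]
    apply (simp add: E_simps; use m(2) in \<open>simp add: m(1) field_simps\<close>)
    done
qed

lemma wint_e21:
  assumes pq: "p \<noteq> q"
  shows "has_wint p \<epsilon> q \<delta> (\<lambda>u w a. e_op \<sigma> 2 1 F (gmat t s u w a))
     (E_op \<sigma> 2 1 (fourier_kernel F) t s (p + 3/2) \<epsilon> (q + 3/2) \<delta>)"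
proof -
  obtain m where m: "p = q + m" "m \<noteq> 0" using pq that[of "p - q"] by simp
  show ?thesis
    apply (rule has_wint_eqI[OF has_wint_add[OF has_wint_cmult[OF wint_A[where i=1 and j=0 and n=0], of "- 1"]
      has_wint_add[OF has_wint_cmult[OF wint_U[where i=1 and j=0 and n=0], of "- of_real t"]
      has_wint_add[OF has_wint_cmult[OF wint_A[where i=0 and j=0 and n=1], of "of_real t"]
      has_wint_add[OF has_wint_cmult[OF wint_W[where i=0 and j=1 and n=0], of "of_real t"]
      has_wint_add[OF has_wint_cmult[OF wint_K[where i=0 and j=0], of "of_real t * (p - q - 1)"]
      has_wint_cmult[OF wint_T[where i=0 and j=0], of "- (of_real t ^ 2)"]]]]]]])
     apply (use pq in \<open>simp add: e_simps field_simps\<close>)[1]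
    apply (simp add: E_simps; use m(2) in \<open>simp add: m(1) field_simps\<close>)
    done
qed

lemma wint_e22:
  assumes pq: "p \<noteq> q"
  shows "has_wint p \<epsilon> q \<delta> (\<lambda>u w a. e_op \<sigma> 2 2 F (gmat t s u w a))
     (E_op \<sigma> 2 2 (fourier_kernel F) t s (p + 3/2) \<epsilon> (q + 3/2) \<delta>)"
proof -
  obtain m where m: "p = q + m" "m \<noteq> 0" using pq that[of "p - q"] by simp
  show ?thesis
    apply (rule has_wint_eqI[OF has_wint_add[OF has_wint_cmult[OF wint_A[where i=0 and j=0 and n=1], of "- 1"]
      has_wint_add[OF has_wint_cmult[OF wint_W[where i=0 and j=1 and n=0], of "- 1"]
      has_wint_add[OF has_wint_cmult[OF wint_K[where i=0 and j=0], of "q + 2"]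
      has_wint_cmult[OF wint_T[where i=0 and j=0], of "of_real t"]]]]])
     apply (use pq in \<open>simp add: e_simps field_simps\<close>)[1]
    apply (simp add: E_simps; use m(2) in \<open>simp add: m(1) field_simps\<close>)
    done
qed

lemma wint_e23:
  assumes pq: "p \<noteq> q"
  shows "has_wint p \<epsilon> q \<delta> (\<lambda>u w a. e_op \<sigma> 2 3 F (gmat t s u w a))
     (E_op \<sigma> 2 3 (fourier_kernel F) t s (p + 3/2) \<epsilon> (q + 3/2) \<delta>)"
proof -
  obtain m where m: "p = q + m" "m \<noteq> 0" using pq that[of "p - q"] by simp
  show ?thesis
    apply (rule has_wint_eqI[OF has_wint_add[OF has_wint_cmult[OF wint_A[where i=0 and j=0 and n=0], of "1"]
      has_wint_add[OF has_wint_cmult[OF wint_U[where i=0 and j=0 and n=0], of "of_real t"]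
      has_wint_add[OF has_wint_cmult[OF wint_W[where i=0 and j=0 and n=0], of "- of_real s"]
      has_wint_add[OF has_wint_cmult[OF wint_K[where i="- 1" and j=0], of "of_real t * (\<sigma> - 1 - p)"]
      has_wint_add[OF has_wint_cmult[OF wint_K[where i=0 and j="- 1"], of "of_real s * (q - \<sigma> + 1)"]
      has_wint_add[OF has_wint_cmult[OF wint_S[where i="- 1" and j=0], of "- (of_real s * of_real t)"]
      has_wint_add[OF has_wint_cmult[OF wint_W[where i="- 1" and j=0 and n=1], of "of_real s * of_real t"]
      has_wint_cmult[OF wint_a_minus[OF pq], of "of_real s * of_real t * (\<sigma> - 1 - q)"]]]]]]]]])
     apply (use pq in \<open>simp add: e_simps field_simps\<close>)[1]
    apply (simp add: E_simps; use m(2) in \<open>simp add: m(1) field_simps\<close>)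
    done
qed

lemma wint_e24:
  assumes pq: "p \<noteq> q"
  shows "has_wint p \<epsilon> q \<delta> (\<lambda>u w a. e_op \<sigma> 2 4 F (gmat t s u w a))
     (E_op \<sigma> 2 4 (fourier_kernel F) t s (p + 3/2) \<epsilon> (q + 3/2) \<delta>)"
proof -
  obtain m where m: "p = q + m" "m \<noteq> 0" using pq that[of "p - q"] by simp
  show ?thesis
    apply (rule has_wint_eqI[OF has_wint_add[OF has_wint_cmult[OF wint_W[where i=0 and j=0 and n=0], of "1"]
      has_wint_add[OF has_wint_cmult[OF wint_K[where i=0 and j="- 1"], of "\<sigma> - 1 - q"]
      has_wint_add[OF has_wint_cmult[OF wint_S[where i="- 1" and j=0], of "of_real t"]
      has_wint_add[OF has_wint_cmult[OF wint_W[where i="- 1" and j=0 and n=1], of "- of_real t"]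
      has_wint_cmult[OF wint_a_minus[OF pq], of "of_real t * (q - \<sigma> + 1)"]]]]]])
     apply (use pq in \<open>simp add: e_simps field_simps\<close>)[1]
    apply (simp add: E_simps; use m(2) in \<open>simp add: m(1) field_simps\<close>)
    done
qed

lemma wint_e31:
  assumes pq: "p \<noteq> q"
  shows "has_wint p \<epsilon> q \<delta> (\<lambda>u w a. e_op \<sigma> 3 1 F (gmat t s u w a))
     (E_op \<sigma> 3 1 (fourier_kernel F) t s (p + 3/2) \<epsilon> (q + 3/2) \<delta>)"
proof -
  obtain m where m: "p = q + m" "m \<noteq> 0" using pq that[of "p - q"] by simp
  show ?thesis
    apply (rule has_wint_eqI[OF has_wint_add[OF has_wint_cmult[OF wint_U[where i=2 and j=0 and n=0], of "- 1"]
      has_wint_add[OF has_wint_cmult[OF wint_K[where i=1 and j=0], of "p + \<sigma> + 2"]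
      has_wint_add[OF has_wint_cmult[OF wint_T[where i=1 and j=0], of "- of_real t"]
      has_wint_add[OF has_wint_cmult[OF wint_A[where i=1 and j=0 and n=1], of "- 1"]
      has_wint_add[OF has_wint_cmult[OF wint_A[where i=0 and j=0 and n=2], of "of_real t"]
      has_wint_add[OF has_wint_cmult[OF wint_W[where i=0 and j=1 and n=1], of "of_real t"]
      has_wint_cmult[OF wint_a_plus[OF pq], of "- (of_real t * (q + \<sigma> + 2))"]]]]]]]])
     apply (use pq in \<open>simp add: e_simps field_simps\<close>)[1]
    apply (simp add: E_simps; use m(2) in \<open>simp add: m(1) field_simps\<close>)
    done
qed

lemma wint_e32:
  assumes pq: "p \<noteq> q"
  shows "has_wint p \<epsilon> q \<delta> (\<lambda>u w a. e_op \<sigma> 3 2 F (gmat t s u w a))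
     (E_op \<sigma> 3 2 (fourier_kernel F) t s (p + 3/2) \<epsilon> (q + 3/2) \<delta>)"
proof -
  obtain m where m: "p = q + m" "m \<noteq> 0" using pq that[of "p - q"] by simp
  show ?thesis
    apply (rule has_wint_eqI[OF has_wint_add[OF has_wint_cmult[OF wint_T[where i=1 and j=0], of "1"]
      has_wint_add[OF has_wint_cmult[OF wint_A[where i=0 and j=0 and n=2], of "- 1"]
      has_wint_add[OF has_wint_cmult[OF wint_W[where i=0 and j=1 and n=1], of "- 1"]
      has_wint_cmult[OF wint_a_plus[OF pq], of "q + \<sigma> + 2"]]]]])
     apply (use pq in \<open>simp add: e_simps field_simps\<close>)[1]
    apply (simp add: E_simps; use m(2) in \<open>simp add: m(1) field_simps\<close>)
    done
qed

lemma wint_e33: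
  assumes pq: "p \<noteq> q"
  shows "has_wint p \<epsilon> q \<delta> (\<lambda>u w a. e_op \<sigma> 3 3 F (gmat t s u w a))
     (E_op \<sigma> 3 3 (fourier_kernel F) t s (p + 3/2) \<epsilon> (q + 3/2) \<delta>)"
proof -
  obtain m where m: "p = q + m" "m \<noteq> 0" using pq that[of "p - q"] by simp
  show ?thesis
    apply (rule has_wint_eqI[OF has_wint_add[OF has_wint_cmult[OF wint_U[where i=1 and j=0 and n=0], of "1"]
      has_wint_add[OF has_wint_cmult[OF wint_A[where i=0 and j=0 and n=1], of "1"]
      has_wint_add[OF has_wint_cmult[OF wint_K[where i=0 and j=0], of "- (p + 2)"]
      has_wint_cmult[OF wint_S[where i=0 and j=0], of "- of_real s"]]]]])
     apply (use pq in \<open>simp add: e_simps field_simps\<close>)[1]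
    apply (simp add: E_simps; use m(2) in \<open>simp add: m(1) field_simps\<close>)
    done
qed

lemma wint_e34:
  assumes pq: "p \<noteq> q"
  shows "has_wint p \<epsilon> q \<delta> (\<lambda>u w a. e_op \<sigma> 3 4 F (gmat t s u w a))
     (E_op \<sigma> 3 4 (fourier_kernel F) t s (p + 3/2) \<epsilon> (q + 3/2) \<delta>)"
proof -
  obtain m where m: "p = q + m" "m \<noteq> 0" using pq that[of "p - q"] by simp
  show ?thesis
    apply (rule has_wint_eqI[OF has_wint_cmult[OF wint_S[where i=0 and j=0], of "1"]])
     apply (use pq in \<open>simp add: e_simps field_simps\<close>)[1]
    apply (simp add: E_simps; use m(2) in \<open>simp add: m(1) field_simps\<close>)
    done
qed

lemma wint_e41:
  assumes pq: "p \<noteq> q"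
  shows "has_wint p \<epsilon> q \<delta> (\<lambda>u w a. e_op \<sigma> 4 1 F (gmat t s u w a))
     (E_op \<sigma> 4 1 (fourier_kernel F) t s (p + 3/2) \<epsilon> (q + 3/2) \<delta>)"
proof -
  obtain m where m: "p = q + m" "m \<noteq> 0" using pq that[of "p - q"] by simp
  show ?thesis
    apply (rule has_wint_eqI[OF has_wint_add[OF has_wint_cmult[OF wint_U[where i=2 and j=0 and n=0], of "(of_real s) * (- 1)"]
      has_wint_add[OF has_wint_cmult[OF wint_K[where i=1 and j=0], of "(of_real s) * (p + \<sigma> + 2)"]
      has_wint_add[OF has_wint_cmult[OF wint_T[where i=1 and j=0], of "(of_real s) * (- of_real t)"]
      has_wint_add[OF has_wint_cmult[OF wint_A[where i=1 and j=0 and n=1], of "(of_real s) * (- 1)"]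
      has_wint_add[OF has_wint_cmult[OF wint_A[where i=0 and j=0 and n=2], of "(of_real s) * (of_real t)"]
      has_wint_add[OF has_wint_cmult[OF wint_W[where i=0 and j=1 and n=1], of "(of_real s) * (of_real t)"]
      has_wint_add[OF has_wint_cmult[OF wint_a_plus[OF pq], of "(of_real s) * (- (of_real t * (q + \<sigma> + 2)))"]
      has_wint_add[OF has_wint_cmult[OF wint_A[where i=1 and j=1 and n=0], of "- 1"]
      has_wint_add[OF has_wint_cmult[OF wint_A[where i=0 and j=1 and n=1], of "of_real t"]
      has_wint_add[OF has_wint_cmult[OF wint_W[where i=0 and j=2 and n=0], of "of_real t"]
      has_wint_cmult[OF wint_K[where i=0 and j=1], of "- (of_real t * (q + \<sigma> + 2))"]]]]]]]]]]]])
     apply (use pq in \<open>simp add: e_simps field_simps\<close>)[1]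
    apply (simp add: E_simps; use m(2) in \<open>simp add: m(1) field_simps\<close>)
    done
qed

lemma wint_e42:
  assumes pq: "p \<noteq> q"
  shows "has_wint p \<epsilon> q \<delta> (\<lambda>u w a. e_op \<sigma> 4 2 F (gmat t s u w a))
     (E_op \<sigma> 4 2 (fourier_kernel F) t s (p + 3/2) \<epsilon> (q + 3/2) \<delta>)"
proof -
  obtain m where m: "p = q + m" "m \<noteq> 0" using pq that[of "p - q"] by simp
  show ?thesis
    apply (rule has_wint_eqI[OF has_wint_add[OF has_wint_cmult[OF wint_T[where i=1 and j=0], of "(of_real s) * (1)"]
      has_wint_add[OF has_wint_cmult[OF wint_A[where i=0 and j=0 and n=2], of "(of_real s) * (- 1)"]
      has_wint_add[OF has_wint_cmult[OF wint_W[where i=0 and j=1 and n=1], of "(of_real s) * (- 1)"]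
      has_wint_add[OF has_wint_cmult[OF wint_a_plus[OF pq], of "(of_real s) * (q + \<sigma> + 2)"]
      has_wint_add[OF has_wint_cmult[OF wint_A[where i=0 and j=1 and n=1], of "- 1"]
      has_wint_add[OF has_wint_cmult[OF wint_W[where i=0 and j=2 and n=0], of "- 1"]
      has_wint_cmult[OF wint_K[where i=0 and j=1], of "q + \<sigma> + 2"]]]]]]]])
     apply (use pq in \<open>simp add: e_simps field_simps\<close>)[1]
    apply (simp add: E_simps; use m(2) in \<open>simp add: m(1) field_simps\<close>)
    done
qed

lemma wint_e43:
  assumes pq: "p \<noteq> q"
  shows "has_wint p \<epsilon> q \<delta> (\<lambda>u w a. e_op \<sigma> 4 3 F (gmat t s u w a))
     (E_op \<sigma> 4 3 (fourier_kernel F) t s (p + 3/2) \<epsilon> (q + 3/2) \<delta>)"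
proof -
  obtain m where m: "p = q + m" "m \<noteq> 0" using pq that[of "p - q"] by simp
  show ?thesis
    apply (rule has_wint_eqI[OF has_wint_add[OF has_wint_cmult[OF wint_U[where i=1 and j=0 and n=0], of "of_real s"]
      has_wint_add[OF has_wint_cmult[OF wint_A[where i=0 and j=0 and n=1], of "of_real s"]
      has_wint_add[OF has_wint_cmult[OF wint_K[where i=0 and j=0], of "of_real s * (q - p - 1)"]
      has_wint_add[OF has_wint_cmult[OF wint_S[where i=0 and j=0], of "- (of_real s ^ 2)"]
      has_wint_add[OF has_wint_cmult[OF wint_A[where i=0 and j=1 and n=0], of "1"]
      has_wint_cmult[OF wint_W[where i=0 and j=1 and n=0], of "- of_real s"]]]]]]])
     apply (use pq in \<open>simp add: e_simps field_simps\<close>)[1]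
    apply (simp add: E_simps; use m(2) in \<open>simp add: m(1) field_simps\<close>)
    done
qed

lemma wint_e44:
  assumes pq: "p \<noteq> q"
  shows "has_wint p \<epsilon> q \<delta> (\<lambda>u w a. e_op \<sigma> 4 4 F (gmat t s u w a))
     (E_op \<sigma> 4 4 (fourier_kernel F) t s (p + 3/2) \<epsilon> (q + 3/2) \<delta>)"
proof -
  obtain m where m: "p = q + m" "m \<noteq> 0" using pq that[of "p - q"] by simp
  show ?thesis
    apply (rule has_wint_eqI[OF has_wint_add[OF has_wint_cmult[OF wint_S[where i=0 and j=0], of "of_real s"]
      has_wint_add[OF has_wint_cmult[OF wint_W[where i=0 and j=1 and n=0], of "1"]
      has_wint_cmult[OF wint_K[where i=0 and j=0], of "- (q + 1)"]]]])
     apply (use pq in \<open>simp add: e_simps field_simps\<close>)[1]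
    apply (simp add: E_simps; use m(2) in \<open>simp add: m(1) field_simps\<close>)
    done
qed


end

section \<open>The correspondence of operators\<close>

theorem mainTheorem1:
  fixes \<sigma> \<mu>1 \<mu>2 :: complex and \<epsilon>1 \<epsilon>2 :: bit and t s :: real and k l :: nat
    and F :: "real^2^2 \<Rightarrow> complex"
  assumes "Re \<sigma> = 0"
    and "F \<in> test_functions"
    and "k \<in> {1..4}" and "l \<in> {1..4}"
    and "\<mu>1 \<noteq> \<mu>2"
  shows "fourier_kernel (e_op \<sigma> k l F) t s \<mu>1 \<epsilon>1 \<mu>2 \<epsilon>2
         = E_op \<sigma> k l (fourier_kernel F) t s \<mu>1 \<epsilon>1 \<mu>2 \<epsilon>2"
proof -
  obtain F' where "(\<forall>X. (F has_derivative F' X) (at X)) \<and> (\<forall>V. cc_GL2 (\<lambda>X. F' X V)) \<and> cc_GL2 F"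
    using test_function_C1[OF assms(2)] by (rule exE)
  then have F': "\<And>X. (F has_derivative F' X) (at X)" "\<And>V. cc_GL2 (\<lambda>X. F' X V)" "cc_GL2 F"
    by auto
  define D where "D i j X = F' X (axis i (axis j 1))" for i j X
  have lin: "F' X = (\<lambda>V. of_real (V$1$1) * D 1 1 X + of_real (V$1$2) * D 1 2 X
       + of_real (V$2$1) * D 2 1 X + of_real (V$2$2) * D 2 2 X)" for X
  proof
    fix V :: "real^2^2"
    interpret bounded_linear "F' X" using F'(1) by (rule has_derivative_bounded_linear)
    have "F' X V = F' X (mat2 (V$1$1) (V$1$2) (V$2$1) (V$2$2))" by (simp add: mat2_eta)
    also have "\<dots> = of_real (V$1$1) * D 1 1 X + of_real (V$1$2) * D 1 2 X
       + of_real (V$2$1) * D 2 1 X + of_real (V$2$2) * D 2 2 X"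
      unfolding mat2_def D_def add scaleR by (simp add: scaleR_conv_of_real)
    finally show "F' X V = of_real (V$1$1) * D 1 1 X + of_real (V$1$2) * D 1 2 X
       + of_real (V$2$1) * D 2 1 X + of_real (V$2$2) * D 2 2 X" .
  qed
  have D: "cc_GL2 (D i j)" for i j
    using F'(2)[of "axis i (axis j 1)"] by (simp add: D_def[abs_def])
  interpret C1_GL2_at F "D 1 1" "D 1 2" "D 2 1" "D 2 2" "\<mu>1 - 3/2" "\<mu>2 - 3/2" \<epsilon>1 \<epsilon>2 t s
    by unfold_locales (use F'(1)[unfolded lin] F'(3) D in auto)
  have pq: "\<mu>1 - 3/2 \<noteq> \<mu>2 - 3/2" using assms(5) by simp
  have "k = 1 \<or> k = 2 \<or> k = 3 \<or> k = 4" "l = 1 \<or> l = 2 \<or> l = 3 \<or> l = 4"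
    using assms(3,4) by auto
  then have "has_wint (\<mu>1 - 3/2) \<epsilon>1 (\<mu>2 - 3/2) \<epsilon>2 (\<lambda>u w a. e_op \<sigma> k l F (gmat t s u w a))
      (E_op \<sigma> k l (fourier_kernel F) t s (\<mu>1 - 3/2 + 3/2) \<epsilon>1 (\<mu>2 - 3/2 + 3/2) \<epsilon>2)"
    by (elim disjE; simp only:; intro wint_e11 wint_e12 wint_e13 wint_e14 wint_e21 wint_e22 wint_e23 wint_e24
        wint_e31 wint_e32 wint_e33 wint_e34 wint_e41 wint_e42 wint_e43 wint_e44 pq)
  from has_wint_kint[OF this] show ?thesis
    by (simp add: fourier_kernel_eq_kint[OF cc_GL2_e_op[OF assms(3,4)]])
qed

end
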